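(* Let $X$ be a non-empty topological space, $Y$ a topological space, $f\colon X\to\mathbb{R}$ and $g\colon Y\to\mathbb{R}$ continuous functions, and $\Gamma\colon X\times[0,1]\to Y$ a continuous map such that $\mathbf{d}(f\circ\pi_1,g\circ\Gamma)\in\mathbb{R}^\circ\times\mathbb{R}$ (i.e. both entries are finite), where $\pi_1\colon X\times[0,1]\to X$ is the projection. Let $\varphi:=\Gamma(-,0)$ and $\psi:=\Gamma(-,1)$, and $$a:=\mathbf{d}(f,g\circ\varphi),\qquad b:=\mathbf{d}(f,g\circ\psi),\qquad c:=\mathbf{d}(f\circ\pi_1,g\circ\Gamma)$$ (so $a\preceq c$ and $b\preceq c$). Then the two composite natural transformations $$h(g)\circ\alpha_c\xrightarrow{h(\varphi)\circ\alpha_c}h(g\circ\varphi)\circ\alpha_c\xrightarrow{h(g\circ\varphi)\circ\alpha_{a\preceq c}}h(g\circ\varphi)\circ\alpha_a\xrightarrow{\vec h(f,g\circ\varphi)}h(f)$$ and $$h(g)\circ\alpha_c\xrightarrow{h(\psi)\circ\alpha_c}h(g\circ\psi)\circ\alpha_c\xrightarrow{h(g\circ\psi)\circ\alpha_{b\preceq c}}h(g\circ\psi)\circ\alpha_b\xrightarrow{\vec h(f,g\circ\psi)}h(f)$$ are equal.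
   Context: Strip. $\mathbb{M}=\{(x,y)\in\mathbb{R}^2:-\pi\le x+y\le\pi\}$, ordered by $(x,y)\preceq(x',y')$ iff $x\ge x'$ and $y\le y'$; $l_0=\{x+y=-\pi\}$, $l_1=\{x+y=\pi\}$; $T(x,y)=(-\pi-y,\pi-x)$ is an automorphism of $\mathbb{M}$. $D=\{(x,y)\in\mathbb{M}:0\le x-y<2\pi\}$ is a fundamental domain for $\langle T\rangle\cong\mathbb{Z}$. For $u=(x,y)\in\mathbb{M}$ put $\rho_1(u)=\{t\in\mathbb{R}:-\pi-y<\arctan t<\pi-x\}$, $\rho_0(u)=\{t\in\mathbb{R}:\arctan t<y\text{ or }\arctan t>x\}$ and $\rho(u)=(\rho_1(u),\rho_0(u))$, a pair of open subsets of $\mathbb{R}$ with $\rho_0(u)\subseteq\rho_1(u)$. Cohomology. $K$ is a field and $\mathcal{H}^\bullet$ is a cohomology theory on pairs of spaces with values in $\mathbb{Z}$-graded $K$-vector spaces, sending weak equivalences to isomorphisms. For pairs $(X_i,A_i)$, $i=1,2$, of open subspaces of a space there is the relative Mayer–Vietoris sequence with differential $\mathcal{H}^{n-1}(X_1\cap X_2,A_1\cap A_2)\to\mathcal{H}^n(X_1\cup X_2,A_1\cup A_2)$ (one fixed sign convention). For an axis-aligned rectangle with lower right corner $p$ and upper left corner $w$, and a monotone assignment of open pairs preserving the corresponding join $w$ (union) and meet $p$ (intersection), "the Mayer–Vietoris differential of the rectangle" is the one for the pairs assigned to the lower left corner (index 1) and the upper right corner (index 2). The functor $h$. For continuous $f\colon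 X\to\mathbb{R}$, with $f^{-1}(U,V)=(f^{-1}(U),f^{-1}(V))$, the contravariant functor $h(f)\colon\mathbb{M}^\circ\to\mathrm{Vect}_K$ is: $h(f)(u)=\mathcal{H}^n(f^{-1}(\rho(T^n(u))))$ for $u\in T^{-n}(D)$. For $u\preceq v$ the internal map $h(f)(u\preceq v)\colon h(f)(v)\to h(f)(u)$ is: the map induced by inclusion if $u,v\in T^{-n}(D)$ for some $n$; if $u\in T^{-n}(D)$, $v\in T^{-n+1}(D)$ and $v\preceq T(u)$, the Mayer–Vietoris differential $\mathcal{H}^{n-1}(f^{-1}(\rho(p)))\to\mathcal{H}^n(f^{-1}(\rho(w)))$ of the axis-aligned rectangle in $D$ with lower right corner $p=T^{n-1}(v)$ and upper left corner $w=T^n(u)$, via $f^{-1}\circ\rho$; and $0$ in all other cases. A continuous map $\varphi\colon X\to Y$ with $g\circ\varphi=f$ induces $h(\varphi)\colon h(g)\to h(f)$, whose component at $u\in T^{-n}(D)$ is the map in $\mathcal{H}^n$ induced by the map of pairs $f^{-1}(\rho(T^n(u)))\to g^{-1}(\rho(T^n(u)))$ given by $\varphi$. In particular any continuous $\varphi\colon X\to Y$ and $g\colon Y\to\mathbb{R}$ give $h(\varphi)\colon h(g)\to h(g\circ\varphi)$. The automorphisms $\alpha_a$. $\mathbb{R}^\circ\times\mathbb{R}$ is $\mathbb{R}^2$ ordered by $(x,y)\preceq(x',y')$ iff $x\ge x'$ and $y\le y'$. $\alpha\colon\mathbb{R}^2\to\operatorname{Aut}(\mathbb{M})$, $a\mapsto\alpha_a$,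 is the unique group homomorphism into the lattice automorphisms of $\mathbb{M}$ with $\alpha_{(a_1,a_2)}(0,0)=(\arctan a_1,\arctan a_2)$. Explicitly $\alpha_a(x,y)=(\pi-\tilde g_a(\pi-x),\tilde g_a(y))$, where $\tilde g_a\colon\mathbb{R}\to\mathbb{R}$ is the continuous map with $\tilde g_a(\theta+2\pi)=\tilde g_a(\theta)+2\pi$, $\tilde g_a(\theta)=\arctan(\tan\theta+a_2)$ on $(-\pi/2,\pi/2)$, $\tilde g_a(\theta)=\pi+\arctan(\tan\theta-a_1)$ on $(\pi/2,3\pi/2)$, and $\tilde g_a$ fixes $\pi/2+\pi\mathbb{Z}$ pointwise. $\alpha$ is monotone and each $\alpha_a$ commutes with $T$. For $b\preceq a$ and $F\colon\mathbb{M}^\circ\to\mathrm{Vect}_K$, $F\circ\alpha_{b\preceq a}\colon F\circ\alpha_a\to F\circ\alpha_b$ has component $F(\alpha_b(u)\preceq\alpha_a(u))$ at $u$. The transformation $\vec h$. For $f,g\colon X\to\mathbb{R}$, $\mathbf{d}(f,g)=(\inf(g-f),\sup(g-f))$. If $f,g$ are continuous and $a=\mathbf{d}(f,g)$ is finite, $\vec h(f,g)\colon h(g)\circ\alpha_a\to h(f)$ is the natural transformation defined as follows. Let $E=\alpha_{-a}(D)$; then $D\subseteq E\cup T(E)$. For $u\in T^{-n}(D)$ let $p=T^n(u)\in D$. If $p\in E$, then $\vec h(f,g)_u\colon\mathcal{H}^n(g^{-1}(\rho(\alpha_a(p))))\to\mathcal{H}^n(f^{-1}(\rho(p)))$ is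 induced by inclusion. If $p\in T(E)$, put $\xi(q)=(g^{-1}(\rho_1(\alpha_a(q))),f^{-1}(\rho_0(q)))$; then $\xi(p)=f^{-1}(\rho(p))$ and $\xi(T^{-1}(p))=g^{-1}(\rho(\alpha_a(T^{-1}(p))))$, and $\vec h(f,g)_u\colon\mathcal{H}^{n-1}(\xi(T^{-1}(p)))\to\mathcal{H}^n(\xi(p))$ is the Mayer–Vietoris differential, via $\xi$, of the axis-aligned rectangle with upper left corner $p$ and lower right corner $T^{-1}(p)$ (whose other two corners lie on $\partial\mathbb{M}=l_0\cup l_1$). *)

theory Defs
  imports "HOL-Analysis.Analysis" "HOL-Algebra.Module"
begin

section \<open>The strip\<close>

type_synonym point = "real \<times> real"

definition strip :: "point set" where
  "strip = {(x, y). - pi \<le> x + y \<and> x + y \<le> pi}"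

text \<open>The order of $\mathbb{R}^\circ\times\mathbb{R}$: the first coordinate is reversed.\<close>

definition preceq :: "point \<Rightarrow> point \<Rightarrow> bool" (infix \<open>\<preceq>\<close> 50) where
  "u \<preceq> v \<longleftrightarrow> fst u \<ge> fst v \<and> snd u \<le> snd v"

definition strip_T :: "point \<Rightarrow> point" where
  "strip_T u = (- pi - snd u, pi - fst u)"

definition T_inv :: "point \<Rightarrow> point" where
  "T_inv u = (pi - snd u, - pi - fst u)"

definition T_pow :: "int \<Rightarrow> point \<Rightarrow> point" where
  "T_pow n = (if n \<ge> 0 then strip_T ^^ nat n else T_inv ^^ nat (- n))"

definition fund_dom :: "point set" where
  "fund_dom = {(x, y). (x, y) \<in> strip \<and> 0 \<le> x - y \<and> x - y < 2 * pi}"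

text \<open>In the comments $T$ and $D$ stand for \<open>strip_T\<close> and \<open>fund_dom\<close>.
  \<open>level u\<close> is the integer $n$ with $u \in T^{-n}(D)$.\<close>

definition level :: "point \<Rightarrow> int" where
  "level u = (THE n. T_pow n u \<in> fund_dom)"

definition \<rho>1 :: "point \<Rightarrow> real set" where
  "\<rho>1 u = {t. - pi - snd u < arctan t \<and> arctan t < pi - fst u}"

definition \<rho>0 :: "point \<Rightarrow> real set" where
  "\<rho>0 u = {t. arctan t < snd u \<or> arctan t > fst u}"

text \<open>
  On the fundamental period $[-\pi/2, 3\pi/2)$, reached by subtracting $2\pi k$, the map
  \<open>g_tilde a\<close> is given by the two tangent formulas; the remaining points are
  those of $\pi/2 + \pi\mathbb{Z}$.
\<close>

definition g_tilde :: "point \<Rightarrow> real \<Rightarrow> real" where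
  "g_tilde a \<theta> =
     (let k = real_of_int \<lfloor>(\<theta> + pi / 2) / (2 * pi)\<rfloor>; \<theta>' = \<theta> - 2 * pi * k in
      if - pi / 2 < \<theta>' \<and> \<theta>' < pi / 2 then arctan (tan \<theta>' + snd a) + 2 * pi * k
      else if pi / 2 < \<theta>' \<and> \<theta>' < 3 * pi / 2 then pi + arctan (tan \<theta>' - fst a) + 2 * pi * k
      else \<theta>)"

definition alpha :: "point \<Rightarrow> point \<Rightarrow> point" where
  "alpha a u = (pi - g_tilde a (pi - fst u), g_tilde a (snd u))"

section \<open>Cohomology theories\<close>

definition linear_maps :: "'k ring \<Rightarrow> ('k, 'v) module \<Rightarrow> ('k, 'w) module \<Rightarrow> ('v \<Rightarrow> 'w) set" where
  "linear_maps K V W = {L \<in> carrier V \<rightarrow> carrier W.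
     (\<forall>x\<in>carrier V. \<forall>y\<in>carrier V. L (x \<oplus>\<^bsub>V\<^esub> y) = L x \<oplus>\<^bsub>W\<^esub> L y) \<and>
     (\<forall>s\<in>carrier K. \<forall>x\<in>carrier V. L (s \<odot>\<^bsub>V\<^esub> x) = s \<odot>\<^bsub>W\<^esub> L x)}"

definition ker_on :: "('k, 'v) module \<Rightarrow> ('k, 'w) module \<Rightarrow> ('v \<Rightarrow> 'w) \<Rightarrow> 'v set" where
  "ker_on V W L = {x \<in> carrier V. L x = \<zero>\<^bsub>W\<^esub>}"

type_synonym 'u space_pair = "'u topology \<times> 'u set"

definition is_pair :: "'u space_pair \<Rightarrow> bool" where
  "is_pair P \<longleftrightarrow> snd P \<subseteq> topspace (fst P)"

definition pair_map :: "'u space_pair \<Rightarrow> 'u space_pair \<Rightarrow> ('u \<Rightarrow> 'u) \<Rightarrow> bool" where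
  "pair_map P Q \<phi> \<longleftrightarrow> continuous_map (fst P) (fst Q) \<phi> \<and> \<phi> ` snd P \<subseteq> snd Q"

definition subpair :: "'u topology \<Rightarrow> 'u set \<times> 'u set \<Rightarrow> 'u space_pair" where
  "subpair X S = (subtopology X (fst S), snd S)"

definition cube :: "nat \<Rightarrow> (nat \<Rightarrow> real) topology" where
  "cube n = product_topology (\<lambda>_. top_of_set {0..1}) {..<n}"

definition cube_boundary :: "nat \<Rightarrow> (nat \<Rightarrow> real) set" where
  "cube_boundary n = {z \<in> topspace (cube n). \<exists>i<n. z i = 0 \<or> z i = 1}"

definition spheroids :: "nat \<Rightarrow> 'a topology \<Rightarrow> 'a \<Rightarrow> ((nat \<Rightarrow> real) \<Rightarrow> 'a) set" where
  "spheroids n X x = {p. continuous_map (cube n) X p \<and> p ` cube_boundary n \<subseteq> {x}}"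

text \<open>Two elements of \<open>spheroids n X x\<close> represent the same element of $\pi_n(X, x)$.\<close>

definition spheroid_homotopic ::
    "nat \<Rightarrow> 'a topology \<Rightarrow> 'a \<Rightarrow> ((nat \<Rightarrow> real) \<Rightarrow> 'a) \<Rightarrow> ((nat \<Rightarrow> real) \<Rightarrow> 'a) \<Rightarrow> bool" where
  "spheroid_homotopic n X x = homotopic_with (\<lambda>r. r ` cube_boundary n \<subseteq> {x}) (cube n) X"

text \<open>
  A continuous map is a weak equivalence if it is bijective on path components and on
  $\pi_n(-, x)$ for all $n \ge 1$ and all base points $x$; injectivity and surjectivity are
  spelled out on representatives.
\<close>

definition weak_equivalence :: "'a topology \<Rightarrow> 'b topology \<Rightarrow> ('a \<Rightarrow> 'b) \<Rightarrow> bool" where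
  "weak_equivalence X Y \<phi> \<longleftrightarrow>
     continuous_map X Y \<phi> \<and>
     (\<forall>x\<in>topspace X. \<forall>x'\<in>topspace X.
        path_component_of Y (\<phi> x) (\<phi> x') \<longrightarrow> path_component_of X x x') \<and>
     (\<forall>y\<in>topspace Y. \<exists>x\<in>topspace X. path_component_of Y (\<phi> x) y) \<and>
     (\<forall>n\<ge>1. \<forall>x\<in>topspace X.
        (\<forall>p\<in>spheroids n X x. \<forall>q\<in>spheroids n X x.
           spheroid_homotopic n Y (\<phi> x) (\<phi> \<circ> p) (\<phi> \<circ> q) \<longrightarrow> spheroid_homotopic n X x p q) \<and>
        (\<forall>q\<in>spheroids n Y (\<phi> x). \<exists>p\<in>spheroids n X x.
           spheroid_homotopic n Y (\<phi> x) (\<phi> \<circ> p) q))"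

definition weak_equivalence_pair :: "'u space_pair \<Rightarrow> 'u space_pair \<Rightarrow> ('u \<Rightarrow> 'u) \<Rightarrow> bool" where
  "weak_equivalence_pair P Q \<phi> \<longleftrightarrow>
     pair_map P Q \<phi> \<and> weak_equivalence (fst P) (fst Q) \<phi> \<and>
     weak_equivalence (subtopology (fst P) (snd P)) (subtopology (fst Q) (snd Q)) \<phi>"

text \<open>
  The spaces are the topologies on subsets of the type \<open>'u\<close>, which is the universe of points.
  \<open>Hgrp n P\<close> is $\mathcal{H}^n(P)$; \<open>Hmap n P Q \<phi>\<close> is the map
  $\mathcal{H}^n(Q)\to\mathcal{H}^n(P)$ induced by $\varphi\colon P\to Q$, and
  \<open>Hdelta n (X, A)\<close> is the connecting map
  $\mathcal{H}^n(A,\emptyset)\to\mathcal{H}^{n+1}(X,A)$.  Their values are meaningful only on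
  pairs, maps of pairs and carriers.
\<close>

record ('u, 'k, 'v) cohomology =
  Hgrp :: "int \<Rightarrow> 'u space_pair \<Rightarrow> ('k, 'v) module"
  Hmap :: "int \<Rightarrow> 'u space_pair \<Rightarrow> 'u space_pair \<Rightarrow> ('u \<Rightarrow> 'u) \<Rightarrow> 'v \<Rightarrow> 'v"
  Hdelta :: "int \<Rightarrow> 'u space_pair \<Rightarrow> 'v \<Rightarrow> 'v"

definition Hiso where
  "Hiso \<H> n P Q \<phi> \<longleftrightarrow> bij_betw (Hmap \<H> n P Q \<phi>) (carrier (Hgrp \<H> n Q)) (carrier (Hgrp \<H> n P))"

locale cohomology_theory = field K for K :: "'k ring" +
  fixes \<H> :: "('u, 'k, 'v) cohomology"
  assumes Hgrp_vector_space: "is_pair P \<Longrightarrow> module K (Hgrp \<H> n P)"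
    and Hmap_linear: "\<lbrakk>is_pair P; is_pair Q; pair_map P Q \<phi>\<rbrakk>
      \<Longrightarrow> Hmap \<H> n P Q \<phi> \<in> linear_maps K (Hgrp \<H> n Q) (Hgrp \<H> n P)"
    and Hmap_cong: "\<lbrakk>is_pair P; is_pair Q; pair_map P Q \<phi>;
        \<And>x. x \<in> topspace (fst P) \<Longrightarrow> \<phi> x = \<psi> x; z \<in> carrier (Hgrp \<H> n Q)\<rbrakk>
      \<Longrightarrow> Hmap \<H> n P Q \<phi> z = Hmap \<H> n P Q \<psi> z"
    and Hmap_id: "\<lbrakk>is_pair P; z \<in> carrier (Hgrp \<H> n P)\<rbrakk> \<Longrightarrow> Hmap \<H> n P P id z = z"
    and Hmap_comp: "\<lbrakk>is_pair P; is_pair Q; is_pair R; pair_map P Q \<phi>; pair_map Q R \<psi>;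
        z \<in> carrier (Hgrp \<H> n R)\<rbrakk>
      \<Longrightarrow> Hmap \<H> n P R (\<psi> \<circ> \<phi>) z = Hmap \<H> n P Q \<phi> (Hmap \<H> n Q R \<psi> z)"
    and Hdelta_linear: "is_pair (X, A)
      \<Longrightarrow> Hdelta \<H> n (X, A)
            \<in> linear_maps K (Hgrp \<H> n (subtopology X A, {})) (Hgrp \<H> (n + 1) (X, A))"
    and Hdelta_natural: "\<lbrakk>is_pair (X, A); is_pair (Y, B); pair_map (X, A) (Y, B) \<phi>;
        z \<in> carrier (Hgrp \<H> n (subtopology Y B, {}))\<rbrakk>
      \<Longrightarrow> Hdelta \<H> n (X, A) (Hmap \<H> n (subtopology X A, {}) (subtopology Y B, {}) \<phi> z)
          = Hmap \<H> (n + 1) (X, A) (Y, B) \<phi> (Hdelta \<H> n (Y, B) z)"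
    and homotopy: "\<lbrakk>is_pair (X, A); is_pair (Y, B);
        homotopic_with (\<lambda>\<kappa>. \<kappa> ` A \<subseteq> B) X Y \<phi> \<psi>; z \<in> carrier (Hgrp \<H> n (Y, B))\<rbrakk>
      \<Longrightarrow> Hmap \<H> n (X, A) (Y, B) \<phi> z = Hmap \<H> n (X, A) (Y, B) \<psi> z"
    and exact_pair: "is_pair (X, A)
      \<Longrightarrow> ker_on (Hgrp \<H> (n + 1) (X, A)) (Hgrp \<H> (n + 1) (X, {})) (Hmap \<H> (n + 1) (X, {}) (X, A) id)
          = Hdelta \<H> n (X, A) ` carrier (Hgrp \<H> n (subtopology X A, {}))"
    and exact_space: "is_pair (X, A)
      \<Longrightarrow> ker_on (Hgrp \<H> n (X, {})) (Hgrp \<H> n (subtopology X A, {}))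
            (Hmap \<H> n (subtopology X A, {}) (X, {}) id)
          = Hmap \<H> n (X, {}) (X, A) id ` carrier (Hgrp \<H> n (X, A))"
    and exact_subspace: "is_pair (X, A)
      \<Longrightarrow> ker_on (Hgrp \<H> n (subtopology X A, {})) (Hgrp \<H> (n + 1) (X, A)) (Hdelta \<H> n (X, A))
          = Hmap \<H> n (subtopology X A, {}) (X, {}) id ` carrier (Hgrp \<H> n (X, {}))"
    and excision: "\<lbrakk>is_pair (X, A); U \<subseteq> A; X closure_of U \<subseteq> X interior_of A\<rbrakk>
      \<Longrightarrow> Hiso \<H> n (subtopology X (topspace X - U), A - U) (X, A) id"
    and weak_equivalence: "\<lbrakk>is_pair P; is_pair Q; weak_equivalence_pair P Q \<phi>\<rbrakk>
      \<Longrightarrow> Hiso \<H> n P Q \<phi>"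

section \<open>The relative Mayer--Vietoris differential\<close>

text \<open>
  If the universe \<open>'u\<close> is closed under products with the real line, then \<open>encode\<close> is an
  injection witnessing this, and \<open>encoded\<close> turns a space with points in \<open>'u \<times> real\<close> into a
  homeomorphic space with points in \<open>'u\<close>.
\<close>

definition encode :: "'u \<times> real \<Rightarrow> 'u" where
  "encode = (SOME e. inj e)"

definition encoded :: "('u \<times> real) topology \<Rightarrow> 'u topology" where
  "encoded Z = pullback_topology (range encode) (inv_into UNIV encode) Z"

definition cylinder :: "'u topology \<Rightarrow> 'u topology" where
  "cylinder X = encoded (prod_topology X (top_of_set {0..1}))"

text \<open>The double mapping cylinder $S_1\times 0\cup(S_1\cap S_2)\times[0,1]\cup S_2\times 1$.\<close>

definition double_cyl :: "'u set \<Rightarrow> 'u set \<Rightarrow> ('u \<times> real) set" where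
  "double_cyl S1 S2 = S1 \<times> {0} \<union> (S1 \<inter> S2) \<times> {0..1} \<union> S2 \<times> {1}"

text \<open>
  Let $A_i\subseteq X_i$ $(i = 1, 2)$ be open subspaces of $X$, let $N$ and $B$ be the double
  mapping cylinders of $X_1, X_2$ and of $A_1, A_2$, and let $M=(X_1\cap X_2)\times(0,1)$ be the
  open middle part of $N$.  The parts of $N$ with $t<1/3$ and with $t>2/3$ are open
  neighbourhoods of the two ends.  With
  $S = M\cap(\{t<1/3\}\cup\{t>2/3\}\cup B)$ and $R=M\cap(\{t<1/3\}\cup B)$,
  the differential is the composite
  $\mathcal{H}^{n-1}(X_1\cap X_2,A_1\cap A_2)
    \cong\mathcal{H}^{n-1}(M\cap\{t>2/3\},M\cap B\cap\{t>2/3\})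
    \cong\mathcal{H}^{n-1}(S,R)
    \cong\mathcal{H}^n(M,S)
    \cong\mathcal{H}^n(N,(N\cap(\{t<1/3\}\cup\{t>2/3\}))\cup B)
    \to\mathcal{H}^n(N,B)
    \cong\mathcal{H}^n(X_1\cup X_2,A_1\cup A_2)$.
  The first and last isomorphisms come from the projection (a homotopy equivalence and a weak
  equivalence of pairs), the second and fourth are excisions (of $S\setminus\{t>2/3\}$ and of
  $N\setminus M$), and the third is the connecting map of the triple $(M,S,R)$; the first four
  together are the suspension isomorphism.
  On cocycles this is the sign convention $c=c_1-c_2\mapsto dc_i$ with $c_i$ a cochain
  on $(X_i,A_i)$.
\<close>

definition mv_differential ::
    "('u, 'k, 'v) cohomology \<Rightarrow> int \<Rightarrow> 'u topology \<Rightarrow> 'u set \<times> 'u set \<Rightarrow> 'u set \<times> 'u set \<Rightarrow> 'v \<Rightarrow> 'v"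
  where
  "mv_differential \<H> n X P1 P2 =
    (let X1 = fst P1; A1 = snd P1; X2 = fst P2; A2 = snd P2;
         Z = cylinder X;
         N = encode ` double_cyl X1 X2;
         B = encode ` double_cyl A1 A2;
         M = N \<inter> encode ` (UNIV \<times> {0<..<1});
         lower = encode ` (UNIV \<times> {..<1/3});
         upper = encode ` (UNIV \<times> {2/3<..});
         S = M \<inter> (lower \<union> upper \<union> B);
         R = M \<inter> (lower \<union> B);
         NB = N \<inter> (lower \<union> upper) \<union> B;
         proj = fst \<circ> inv_into UNIV encode;
         incl = (\<lambda>m Q1 Q2. Hmap \<H> m (subpair Z Q1) (subpair Z Q2) id);
         incl_inv = (\<lambda>m Q1 Q2. inv_into (carrier (Hgrp \<H> m (subpair Z Q2))) (incl m Q1 Q2));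
         join = subpair X (X1 \<union> X2, A1 \<union> A2);
         meet = subpair X (X1 \<inter> X2, A1 \<inter> A2)
     in inv_into (carrier (Hgrp \<H> n join)) (Hmap \<H> n (subpair Z (N, B)) join proj)
        \<circ> incl n (N, B) (N, NB)
        \<circ> incl_inv n (M, S) (N, NB)
        \<circ> Hdelta \<H> (n - 1) (subpair Z (M, S))
        \<circ> incl (n - 1) (S, {}) (S, R)
        \<circ> incl_inv (n - 1) (M \<inter> upper, M \<inter> B \<inter> upper) (S, R)
        \<circ> Hmap \<H> (n - 1) (subpair Z (M \<inter> upper, M \<inter> B \<inter> upper)) meet proj)"

text \<open>
  The Mayer--Vietoris differential into degree $n$ of the axis-aligned rectangle with lower
  right corner \<open>p\<close> and upper left corner \<open>w\<close>, for an assignment \<open>F\<close> of open pairs in \<open>X\<close>: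
  index 1 is the lower left corner and index 2 the upper right corner.
\<close>

definition mv_rectangle ::
    "('u, 'k, 'v) cohomology \<Rightarrow> int \<Rightarrow> 'u topology \<Rightarrow> (point \<Rightarrow> 'u set \<times> 'u set)
      \<Rightarrow> point \<Rightarrow> point \<Rightarrow> 'v \<Rightarrow> 'v" where
  "mv_rectangle \<H> n X F p w = mv_differential \<H> n X (F (fst w, snd p)) (F (fst p, snd w))"

section \<open>Contravariant functors on the strip\<close>

text \<open>
  \<open>mor F u v\<close>, for \<open>u \<preceq> v\<close>, is the internal map from \<open>ob F v\<close> to \<open>ob F u\<close>.
  Families of maps indexed by points (natural transformations) have type
  \<open>point \<Rightarrow> 'v \<Rightarrow> 'v\<close>.
\<close>

record ('k, 'v) strip_functor =
  ob :: "point \<Rightarrow> ('k, 'v) module"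
  mor :: "point \<Rightarrow> point \<Rightarrow> 'v \<Rightarrow> 'v"

text \<open>$F\circ\alpha_a$, $\eta\circ\alpha_a$, $F\circ\alpha_{b\preceq a}$ and vertical composition.\<close>

definition shift :: "('k, 'v) strip_functor \<Rightarrow> point \<Rightarrow> ('k, 'v) strip_functor" where
  "shift F a = \<lparr>ob = (\<lambda>u. ob F (alpha a u)), mor = (\<lambda>u v. mor F (alpha a u) (alpha a v))\<rparr>"

definition shift_nt :: "(point \<Rightarrow> 'v \<Rightarrow> 'v) \<Rightarrow> point \<Rightarrow> point \<Rightarrow> 'v \<Rightarrow> 'v" where
  "shift_nt \<eta> a = (\<lambda>u. \<eta> (alpha a u))"

definition shift_le :: "('k, 'v) strip_functor \<Rightarrow> point \<Rightarrow> point \<Rightarrow> point \<Rightarrow> 'v \<Rightarrow> 'v" where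
  "shift_le F b a = (\<lambda>u. mor F (alpha b u) (alpha a u))"

definition nt_comp :: "(point \<Rightarrow> 'v \<Rightarrow> 'v) \<Rightarrow> (point \<Rightarrow> 'v \<Rightarrow> 'v) \<Rightarrow> point \<Rightarrow> 'v \<Rightarrow> 'v"
    (infixr \<open>\<odot>\<odot>\<close> 55) where
  "\<eta> \<odot>\<odot> \<theta> = (\<lambda>u. \<eta> u \<circ> \<theta> u)"

section \<open>Relative interlevel set cohomology\<close>

definition preim :: "'u topology \<Rightarrow> ('u \<Rightarrow> real) \<Rightarrow> real set \<Rightarrow> 'u set" where
  "preim X f U = {x \<in> topspace X. f x \<in> U}"

text \<open>\<open>interlevel X f u\<close> is $f^{-1}(\rho(u))$.\<close>

definition interlevel :: "'u topology \<Rightarrow> ('u \<Rightarrow> real) \<Rightarrow> point \<Rightarrow> 'u set \<times> 'u set" where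
  "interlevel X f u = (preim X f (\<rho>1 u), preim X f (\<rho>0 u))"

definition h_fun :: "('u, 'k, 'v) cohomology \<Rightarrow> 'u topology \<Rightarrow> ('u \<Rightarrow> real) \<Rightarrow> ('k, 'v) strip_functor" where
  "h_fun \<H> X f =
    (let H = (\<lambda>u. Hgrp \<H> (level u) (subpair X (interlevel X f (T_pow (level u) u)))) in
     \<lparr>ob = H,
      mor = (\<lambda>u v.
        let n = level u in
        if level v = n then
          Hmap \<H> n (subpair X (interlevel X f (T_pow n u))) (subpair X (interlevel X f (T_pow n v))) id
        else if level v = n - 1 \<and> v \<preceq> strip_T u then
          mv_rectangle \<H> n X (interlevel X f) (T_pow (n - 1) v) (T_pow n u)
        else (\<lambda>_. \<zero>\<^bsub>H u\<^esub>))\<rparr>)"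

text \<open>\<open>h_ind \<H> X Y g \<phi>\<close> is $h(\varphi)\colon h(g)\to h(g\circ\varphi)$ for
  $\varphi\colon X\to Y$.\<close>

definition h_ind ::
    "('u, 'k, 'v) cohomology \<Rightarrow> 'u topology \<Rightarrow> 'u topology \<Rightarrow> ('u \<Rightarrow> real) \<Rightarrow> ('u \<Rightarrow> 'u)
      \<Rightarrow> point \<Rightarrow> 'v \<Rightarrow> 'v" where
  "h_ind \<H> X Y g \<phi> u =
    (let n = level u; p = T_pow n u in
     Hmap \<H> n (subpair X (interlevel X (g \<circ> \<phi>) p)) (subpair Y (interlevel Y g p)) \<phi>)"

section \<open>The transformation of a distance\<close>

text \<open>$\mathbf{d}(f,g)$ for functions on a set \<open>S\<close>, with values in the extended reals, and the
  pair of real numbers it is if both entries are finite.\<close>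

definition dist_ext :: "'a set \<Rightarrow> ('a \<Rightarrow> real) \<Rightarrow> ('a \<Rightarrow> real) \<Rightarrow> ereal \<times> ereal" where
  "dist_ext S f g = (INF x\<in>S. ereal (g x - f x), SUP x\<in>S. ereal (g x - f x))"

definition finite_pair :: "ereal \<times> ereal \<Rightarrow> bool" where
  "finite_pair d \<longleftrightarrow> \<bar>fst d\<bar> \<noteq> \<infinity> \<and> \<bar>snd d\<bar> \<noteq> \<infinity>"

definition dist_vec :: "'a set \<Rightarrow> ('a \<Rightarrow> real) \<Rightarrow> ('a \<Rightarrow> real) \<Rightarrow> point" where
  "dist_vec S f g = (real_of_ereal (fst (dist_ext S f g)), real_of_ereal (snd (dist_ext S f g)))"

text \<open>
  \<open>h_vec \<H> X f g\<close> is $\vec h(f,g)\colon h(g)\circ\alpha_a\to h(f)$.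
  The second branch is the case $p\in T(E)$, because $D\subseteq E\cup T(E)$.
\<close>

definition h_vec ::
    "('u, 'k, 'v) cohomology \<Rightarrow> 'u topology \<Rightarrow> ('u \<Rightarrow> real) \<Rightarrow> ('u \<Rightarrow> real) \<Rightarrow> point \<Rightarrow> 'v \<Rightarrow> 'v" where
  "h_vec \<H> X f g u =
    (let a = dist_vec (topspace X) f g;
         E = alpha (- a) ` fund_dom;
         n = level u;
         p = T_pow n u;
         \<xi> = (\<lambda>q. (preim X g (\<rho>1 (alpha a q)), preim X f (\<rho>0 q)))
     in if p \<in> E then
          Hmap \<H> n (subpair X (interlevel X f p)) (subpair X (interlevel X g (alpha a p))) id
        else mv_rectangle \<H> n X \<xi> (T_inv p) p)"

end

theory Submission
  imports Defs "HOL-Algebra.AbelCoset"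
begin

text \<open>
  Let \<open>u\<close> have level \<open>n\<close> and put \<open>p = T^n u\<close>, a point of the fundamental domain \<open>D\<close>.  The
  composites at \<open>u\<close> take one of two forms, according to whether \<open>\<alpha>_c\<close> keeps \<open>p\<close> in \<open>D\<close>.

  If \<open>\<alpha>_c p\<close> is in \<open>D\<close>, then so are \<open>\<alpha>_a p\<close> and \<open>\<alpha>_b p\<close>, all maps are induced by maps of
  pairs, and the composites are the maps that \<open>\<phi>\<close> and \<open>\<psi>\<close>, regarded as maps
  \<open>f^-1 (\<rho> p) \<rightarrow> g^-1 (\<rho> (\<alpha>_c p))\<close>, induce in degree \<open>n\<close> (\<open>composite_same_level\<close>).  By the choice
  of \<open>c\<close>, the homotopy \<open>\<Gamma>\<close> runs through such maps of pairs, so the two agree.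

  Otherwise \<open>p = (arctan s, arctan r)\<close> with \<open>r \<le> s\<close> and \<open>s + c_1 < r + c_2\<close>
  (\<open>alpha_leaves_domain\<close>).  Each composite now contains exactly one Mayer--Vietoris differential and
  an inclusion; which of the two comes first depends on whether \<open>\<alpha>_a\<close> alone already moves \<open>p\<close> out of
  \<open>D\<close>.  By naturality of the differential both orders give \<open>\<phi>^*\<close> followed by the differential of the
  pairs \<open>({g \<phi> > s + c_1}, {f > s})\<close> and \<open>({g \<phi> < r + c_2}, {f < r})\<close>
  (\<open>composite_lower_level\<close>).  The same pairs, formed on the cylinder of \<open>X\<close> from \<open>f\<close> after the
  projection and \<open>g \<Gamma>\<close>, have a differential of their own, and the composites for \<open>\<phi>\<close> and \<open>\<psi>\<close> are
  its restrictions along the two ends of the cylinder (\<open>mv_level_cylinder\<close>).  It takes values in the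
  cohomology of the product of \<open>(X, f^-1 (\<rho>_0 p))\<close> with the interval, on which the two ends induce
  the same map.

  What remains is naturality of the differential under arbitrary continuous maps
  (\<open>mv_differential_natural\<close>).  It is a composite of natural maps and of inverses of natural maps,
  so one needs that the inverted maps are bijective.  Two of them are excisions.  The third is the
  projection of a double mapping cylinder to the union; it is a bijection (\<open>Hiso_double_cyl\<close>)
  because excision and contraction of the pieces compare the cohomology of the cylinder relative to
  its part above height 0 with the cohomology of the union relative to the second space, and the
  five lemma passes from relative to absolute cohomology and back.
\<close>

section \<open>Five lemma and long exact sequences\<close>

lemma module_imp_abelian_group: "module K V \<Longrightarrow> abelian_group V"
  by (simp add: module_def)

lemma linear_maps_hom:
  assumes "abelian_group V" "abelian_group W" "L \<in> linear_maps K V W"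
  shows "abelian_group_hom V W L"
proof -
  interpret V: abelian_group V by fact
  interpret W: abelian_group W by fact
  have "L \<in> hom (add_monoid V) (add_monoid W)"
    using assms(3) by (auto simp: linear_maps_def hom_def)
  then show ?thesis
    by (intro abelian_group_homI assms(1,2) group_hom.intro group_hom_axioms.intro
        V.a_group W.a_group)
qed

lemma five_lemma:
  assumes d: "abelian_group_hom V1 V2 d1" "abelian_group_hom V2 V3 d2"
      "abelian_group_hom V3 V4 d3" "abelian_group_hom V4 V5 d4"
    and e: "abelian_group_hom W1 W2 e1" "abelian_group_hom W2 W3 e2"
      "abelian_group_hom W3 W4 e3" "abelian_group_hom W4 W5 e4"
    and t: "abelian_group_hom V1 W1 t1" "abelian_group_hom V2 W2 t2" "abelian_group_hom V3 W3 t3"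
      "abelian_group_hom V4 W4 t4" "abelian_group_hom V5 W5 t5"
    and sq: "\<And>x. x \<in> carrier V1 \<Longrightarrow> t2 (d1 x) = e1 (t1 x)"
      "\<And>x. x \<in> carrier V2 \<Longrightarrow> t3 (d2 x) = e2 (t2 x)"
      "\<And>x. x \<in> carrier V3 \<Longrightarrow> t4 (d3 x) = e3 (t3 x)"
      "\<And>x. x \<in> carrier V4 \<Longrightarrow> t5 (d4 x) = e4 (t4 x)"
    and exV: "ker_on V2 V3 d2 = d1 ` carrier V1" "ker_on V3 V4 d3 = d2 ` carrier V2"
      "ker_on V4 V5 d4 = d3 ` carrier V3"
    and exW: "ker_on W2 W3 e2 = e1 ` carrier W1" "ker_on W3 W4 e3 = e2 ` carrier W2"
      "ker_on W4 W5 e4 = e3 ` carrier W3"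
    and bij: "bij_betw t1 (carrier V1) (carrier W1)" "bij_betw t2 (carrier V2) (carrier W2)"
      "bij_betw t4 (carrier V4) (carrier W4)" "bij_betw t5 (carrier V5) (carrier W5)"
  shows "bij_betw t3 (carrier V3) (carrier W3)"
proof -
  interpret V3: abelian_group V3 using d(2) by (simp add: abelian_group_hom_def)
  interpret W3: abelian_group W3 using e(2) by (simp add: abelian_group_hom_def)
  interpret W4: abelian_group W4 using e(3) by (simp add: abelian_group_hom_def)
  interpret d1: abelian_group_hom V1 V2 d1 by fact
  interpret d2: abelian_group_hom V2 V3 d2 by fact
  interpret d3: abelian_group_hom V3 V4 d3 by fact
  interpret d4: abelian_group_hom V4 V5 d4 by fact
  interpret e1: abelian_group_hom W1 W2 e1 by fact
  interpret e2: abelian_group_hom W2 W3 e2 by fact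
  interpret e3: abelian_group_hom W3 W4 e3 by fact
  interpret e4: abelian_group_hom W4 W5 e4 by fact
  interpret t1: abelian_group_hom V1 W1 t1 by fact
  interpret t2: abelian_group_hom V2 W2 t2 by fact
  interpret t3: abelian_group_hom V3 W3 t3 by fact
  interpret t4: abelian_group_hom V4 W4 t4 by fact
  interpret t5: abelian_group_hom V5 W5 t5 by fact
  have z: "\<zero>\<^bsub>V4\<^esub> \<in> carrier V4" "\<zero>\<^bsub>V5\<^esub> \<in> carrier V5" by auto
  have inj: "x = \<zero>\<^bsub>V3\<^esub>" if x: "x \<in> carrier V3" "t3 x = \<zero>\<^bsub>W3\<^esub>" for x
  proof -
    have "t4 (d3 x) = t4 \<zero>\<^bsub>V4\<^esub>" using x sq(3) by simp
    then have "d3 x = \<zero>\<^bsub>V4\<^esub>"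
      using bij(3) x d3.hom_closed z by (metis bij_betw_imp_inj_on inj_onD)
    then have "x \<in> d2 ` carrier V2" using x exV(2) by (auto simp: ker_on_def)
    then obtain y where y: "y \<in> carrier V2" "x = d2 y" by auto
    have "e2 (t2 y) = \<zero>\<^bsub>W3\<^esub>" using y x sq(2) by simp
    then have "t2 y \<in> e1 ` carrier W1" using y exW(1) by (auto simp: ker_on_def)
    then obtain w where w: "w \<in> carrier W1" "t2 y = e1 w" by auto
    then obtain v where v: "v \<in> carrier V1" "w = t1 v"
      using bij_betw_imp_surj_on[OF bij(1)] by auto
    have "t2 y = t2 (d1 v)" using sq(1) v w by simp
    then have yd: "y = d1 v"
      using bij(2) y v d1.hom_closed by (metis bij_betw_imp_inj_on inj_onD)
    then have "y \<in> ker_on V2 V3 d2" using exV(1) v by simp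
    then show ?thesis using y by (simp add: ker_on_def)
  qed
  have "inj_on t3 (carrier V3)"
  proof (rule inj_onI)
    fix x y assume xy: "x \<in> carrier V3" "y \<in> carrier V3" "t3 x = t3 y"
    have "t3 (x \<ominus>\<^bsub>V3\<^esub> y) = t3 x \<ominus>\<^bsub>W3\<^esub> t3 y"
      using xy by (simp add: a_minus_def)
    also have "\<dots> = \<zero>\<^bsub>W3\<^esub>" using xy by (simp add: W3.r_neg a_minus_def)
    finally have "x \<ominus>\<^bsub>V3\<^esub> y = \<zero>\<^bsub>V3\<^esub>" using xy by (intro inj) auto
    then have "\<zero>\<^bsub>V3\<^esub> \<oplus>\<^bsub>V3\<^esub> y = (x \<ominus>\<^bsub>V3\<^esub> y) \<oplus>\<^bsub>V3\<^esub> y" by simp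
    also have "\<dots> = x" using xy by (simp add: a_minus_def V3.a_assoc V3.l_neg)
    finally show "x = y" using xy by simp
  qed
  moreover have "w \<in> t3 ` carrier V3" if w: "w \<in> carrier W3" for w
  proof -
    have "e3 w \<in> ker_on W4 W5 e4" using exW(3) w by blast
    then have e4: "e4 (e3 w) = \<zero>\<^bsub>W5\<^esub>" by (simp add: ker_on_def)
    obtain v where v: "v \<in> carrier V4" "e3 w = t4 v"
      using bij(3) e3.hom_closed[OF w] by (auto simp: bij_betw_def)
    have "t5 (d4 v) = t5 \<zero>\<^bsub>V5\<^esub>" using sq(4)[OF v(1)] e4 v by simp
    then have "d4 v = \<zero>\<^bsub>V5\<^esub>"
      using bij(4) v d4.hom_closed z by (metis bij_betw_imp_inj_on inj_onD)
    then have "v \<in> d3 ` carrier V3" using v exV(3) by (auto simp: ker_on_def)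
    then obtain x where x: "x \<in> carrier V3" "v = d3 x" by auto
    have e3x: "e3 (t3 x) = e3 w" using sq(3)[OF x(1)] v x by simp
    have "e3 (w \<ominus>\<^bsub>W3\<^esub> t3 x) = e3 w \<ominus>\<^bsub>W4\<^esub> e3 (t3 x)"
      using w x by (simp add: a_minus_def)
    also have "\<dots> = \<zero>\<^bsub>W4\<^esub>" using w x by (simp add: e3x W4.r_neg a_minus_def)
    finally have "w \<ominus>\<^bsub>W3\<^esub> t3 x \<in> e2 ` carrier W2"
      using exW(2) w x by (auto simp: ker_on_def)
    then obtain v2 where v2: "v2 \<in> carrier V2" "w \<ominus>\<^bsub>W3\<^esub> t3 x = e2 (t2 v2)"
      using bij_betw_imp_surj_on[OF bij(2)] by (metis imageE)
    have "t3 (d2 v2 \<oplus>\<^bsub>V3\<^esub> x) = e2 (t2 v2) \<oplus>\<^bsub>W3\<^esub> t3 x" using v2 x sq(2) by simp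
    also have "\<dots> = (w \<ominus>\<^bsub>W3\<^esub> t3 x) \<oplus>\<^bsub>W3\<^esub> t3 x" using v2 by simp
    also have "\<dots> = w" using w x
      by (simp add: a_minus_def W3.a_assoc W3.l_neg)
    finally show ?thesis using v2 x by (metis d2.hom_closed V3.a_closed imageI)
  qed
  ultimately show ?thesis by (auto simp: bij_betw_def)
qed

context cohomology_theory
begin

lemma Hgrp_abelian_group: "is_pair P \<Longrightarrow> abelian_group (Hgrp \<H> n P)"
  using Hgrp_vector_space module_imp_abelian_group by blast

lemma Hmap_hom:
  assumes "is_pair P" "is_pair Q" "pair_map P Q \<phi>"
  shows "abelian_group_hom (Hgrp \<H> n Q) (Hgrp \<H> n P) (Hmap \<H> n P Q \<phi>)"
  using Hmap_linear[OF assms] linear_maps_hom Hgrp_abelian_group assms by blast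

lemma Hmap_closed:
  assumes "is_pair P" "is_pair Q" "pair_map P Q \<phi>" "z \<in> carrier (Hgrp \<H> n Q)"
  shows "Hmap \<H> n P Q \<phi> z \<in> carrier (Hgrp \<H> n P)"
  using Hmap_linear[OF assms(1-3), of n] assms(4) by (auto simp: linear_maps_def)

lemma is_pair_empty [simp]: "is_pair (X, {})"
  by (simp add: is_pair_def)

lemma Hdelta_hom:
  assumes "is_pair (X, A)"
  shows "abelian_group_hom (Hgrp \<H> n (subtopology X A, {})) (Hgrp \<H> (n + 1) (X, A)) (Hdelta \<H> n (X, A))"
  using Hdelta_linear[OF assms] linear_maps_hom Hgrp_abelian_group assms is_pair_empty by blast

text \<open>The form in which functoriality is used: a square of maps of pairs that commutes on points
  commutes in cohomology.\<close>
lemma Hmap_square: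
  assumes "is_pair P" "is_pair Q" "is_pair Q'" "is_pair R"
    and "pair_map P Q \<phi>" "pair_map Q R \<psi>" "pair_map P Q' \<phi>'" "pair_map Q' R \<psi>'"
    and "\<And>x. x \<in> topspace (fst P) \<Longrightarrow> \<psi> (\<phi> x) = \<psi>' (\<phi>' x)"
    and z: "z \<in> carrier (Hgrp \<H> n R)"
  shows "Hmap \<H> n P Q \<phi> (Hmap \<H> n Q R \<psi> z) = Hmap \<H> n P Q' \<phi>' (Hmap \<H> n Q' R \<psi>' z)"
proof -
  have pm: "pair_map P R (\<psi> \<circ> \<phi>)"
    using assms(5,6) by (fastforce simp: pair_map_def intro: continuous_map_compose)
  show ?thesis
    using Hmap_cong[OF assms(1,4) pm, of "\<psi>' \<circ> \<phi>'" z n] assms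
    by (simp add: Hmap_comp[OF assms(1,2,4,5,6)] Hmap_comp[OF assms(1,3,4,7,8)])
qed

lemma pair_map_absolute [simp]: "pair_map (X, {}) (Y, B) \<phi> \<longleftrightarrow> continuous_map X Y \<phi>"
  by (simp add: pair_map_def)

lemma pair_map_restrict:
  assumes "pair_map (X, A) (Y, B) \<phi>"
  shows "continuous_map X Y \<phi>" "continuous_map (subtopology X A) (subtopology Y B) \<phi>"
  using assms
  by (auto simp: pair_map_def continuous_map_in_subtopology continuous_map_from_subtopology)

text \<open>A map of pairs induces a map of long exact sequences.  The five lemma applies with the unknown
  map at the pair or at the total space.\<close>

lemma Hiso_pair:
  assumes P: "is_pair (X, A)" "is_pair (Y, B)" and \<phi>: "pair_map (X, A) (Y, B) \<phi>"
    and tot: "\<And>m. Hiso \<H> m (X, {}) (Y, {}) \<phi>"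
    and sub: "\<And>m. Hiso \<H> m (subtopology X A, {}) (subtopology Y B, {}) \<phi>"
  shows "Hiso \<H> n (X, A) (Y, B) \<phi>"
proof -
  note r = pair_map_restrict[OF \<phi>]
  obtain m where m: "n = m + 1" by (metis diff_add_cancel)
  have id1: "continuous_map (subtopology Z C) Z id" for Z :: "'u topology" and C
    by (simp add: continuous_map_from_subtopology)
  show ?thesis
    unfolding Hiso_def m
    by (rule five_lemma[where
          ?d1.0 = "Hmap \<H> m (subtopology Y B, {}) (Y, {}) id" and ?d2.0 = "Hdelta \<H> m (Y, B)" and
          ?d3.0 = "Hmap \<H> (m + 1) (Y, {}) (Y, B) id" and
          ?d4.0 = "Hmap \<H> (m + 1) (subtopology Y B, {}) (Y, {}) id" and
          ?e1.0 = "Hmap \<H> m (subtopology X A, {}) (X, {}) id" and ?e2.0 = "Hdelta \<H> m (X, A)" and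
          ?e3.0 = "Hmap \<H> (m + 1) (X, {}) (X, A) id" and
          ?e4.0 = "Hmap \<H> (m + 1) (subtopology X A, {}) (X, {}) id" and
          ?t1.0 = "Hmap \<H> m (X, {}) (Y, {}) \<phi>" and
          ?t2.0 = "Hmap \<H> m (subtopology X A, {}) (subtopology Y B, {}) \<phi>" and
          ?t4.0 = "Hmap \<H> (m + 1) (X, {}) (Y, {}) \<phi>" and
          ?t5.0 = "Hmap \<H> (m + 1) (subtopology X A, {}) (subtopology Y B, {}) \<phi>"])
      (assumption | rule P \<phi> r Hmap_hom Hdelta_hom exact_pair exact_space exact_subspace
        Hmap_square Hdelta_natural[symmetric] tot[unfolded Hiso_def] sub[unfolded Hiso_def]
        is_pair_empty | simp add: id1 r)+
qed

lemma Hiso_total: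
  assumes P: "is_pair (X, A)" "is_pair (Y, B)" and \<phi>: "pair_map (X, A) (Y, B) \<phi>"
    and rel: "\<And>m. Hiso \<H> m (X, A) (Y, B) \<phi>"
    and sub: "\<And>m. Hiso \<H> m (subtopology X A, {}) (subtopology Y B, {}) \<phi>"
  shows "Hiso \<H> n (X, {}) (Y, {}) \<phi>"
proof -
  note r = pair_map_restrict[OF \<phi>]
  obtain m where m: "n = m + 1" by (metis diff_add_cancel)
  have id1: "continuous_map (subtopology Z C) Z id" for Z :: "'u topology" and C
    by (simp add: continuous_map_from_subtopology)
  show ?thesis
    unfolding Hiso_def m
    by (rule five_lemma[where
          ?d1.0 = "Hdelta \<H> m (Y, B)" and ?d2.0 = "Hmap \<H> (m + 1) (Y, {}) (Y, B) id" and
          ?d3.0 = "Hmap \<H> (m + 1) (subtopology Y B, {}) (Y, {}) id" and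
          ?d4.0 = "Hdelta \<H> (m + 1) (Y, B)" and
          ?e1.0 = "Hdelta \<H> m (X, A)" and ?e2.0 = "Hmap \<H> (m + 1) (X, {}) (X, A) id" and
          ?e3.0 = "Hmap \<H> (m + 1) (subtopology X A, {}) (X, {}) id" and
          ?e4.0 = "Hdelta \<H> (m + 1) (X, A)" and
          ?t1.0 = "Hmap \<H> m (subtopology X A, {}) (subtopology Y B, {}) \<phi>" and
          ?t2.0 = "Hmap \<H> (m + 1) (X, A) (Y, B) \<phi>" and
          ?t4.0 = "Hmap \<H> (m + 1) (subtopology X A, {}) (subtopology Y B, {}) \<phi>" and
          ?t5.0 = "Hmap \<H> (m + 1 + 1) (X, A) (Y, B) \<phi>"])
      (assumption | rule P \<phi> r Hmap_hom Hdelta_hom exact_pair exact_space exact_subspace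
        Hmap_square Hdelta_natural[symmetric] rel[unfolded Hiso_def] sub[unfolded Hiso_def]
        is_pair_empty | simp add: id1 r)+
qed

lemma Hiso_comp:
  assumes "is_pair P" "is_pair Q" "is_pair R" "pair_map P Q \<phi>" "pair_map Q R \<psi>"
    and "Hiso \<H> n P Q \<phi>" "Hiso \<H> n Q R \<psi>"
  shows "Hiso \<H> n P R (\<psi> \<circ> \<phi>)"
proof -
  have "bij_betw (Hmap \<H> n P Q \<phi> \<circ> Hmap \<H> n Q R \<psi>) (carrier (Hgrp \<H> n R)) (carrier (Hgrp \<H> n P))"
    using bij_betw_trans[OF assms(7,6)[unfolded Hiso_def]] .
  then show ?thesis
    unfolding Hiso_def
    by (rule iffD1[OF bij_betw_cong, rotated]) (simp add: Hmap_comp[OF assms(1-5)])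
qed

lemma Hiso_cancel_left:
  assumes "is_pair P" "is_pair Q" "is_pair R" "pair_map P Q \<phi>" "pair_map Q R \<psi>"
    and "Hiso \<H> n P Q \<phi>" "Hiso \<H> n P R (\<psi> \<circ> \<phi>)"
  shows "Hiso \<H> n Q R \<psi>"
proof -
  have "bij_betw (Hmap \<H> n P Q \<phi> \<circ> Hmap \<H> n Q R \<psi>) (carrier (Hgrp \<H> n R)) (carrier (Hgrp \<H> n P))"
    using assms(7)[unfolded Hiso_def]
    by (rule iffD1[OF bij_betw_cong, rotated]) (simp add: Hmap_comp[OF assms(1-5)])
  moreover have "Hmap \<H> n Q R \<psi> ` carrier (Hgrp \<H> n R) \<subseteq> carrier (Hgrp \<H> n Q)"
    using Hmap_closed[OF assms(2,3,5)] by auto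
  ultimately show ?thesis
    using bij_betw_comp_iff2[OF assms(6)[unfolded Hiso_def]] unfolding Hiso_def by blast
qed

text \<open>The homotopies must respect the subspaces, which is what the predicates express.\<close>
lemma Hiso_homotopy_equivalence:
  assumes P: "is_pair (X, A)" "is_pair (Y, B)"
    and \<phi>: "pair_map (X, A) (Y, B) \<phi>" and \<psi>: "pair_map (Y, B) (X, A) \<psi>"
    and h1: "homotopic_with (\<lambda>\<kappa>. \<kappa> ` A \<subseteq> A) X X (\<psi> \<circ> \<phi>) id"
    and h2: "homotopic_with (\<lambda>\<kappa>. \<kappa> ` B \<subseteq> B) Y Y (\<phi> \<circ> \<psi>) id"
  shows "Hiso \<H> n (X, A) (Y, B) \<phi>"
proof -
  have "Hmap \<H> n (X, A) (Y, B) \<phi> (Hmap \<H> n (Y, B) (X, A) \<psi> z) = z"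
    if z: "z \<in> carrier (Hgrp \<H> n (X, A))" for z
    using Hmap_comp[OF P(1,2,1) \<phi> \<psi> z] homotopy[OF P(1,1) h1 z] Hmap_id[OF P(1) z] by simp
  moreover have "Hmap \<H> n (Y, B) (X, A) \<psi> (Hmap \<H> n (X, A) (Y, B) \<phi> z) = z"
    if z: "z \<in> carrier (Hgrp \<H> n (Y, B))" for z
    using Hmap_comp[OF P(2,1,2) \<psi> \<phi> z] homotopy[OF P(2,2) h2 z] Hmap_id[OF P(2) z] by simp
  ultimately show ?thesis
    unfolding Hiso_def using Hmap_closed[OF P \<phi>] Hmap_closed[OF P(2,1) \<psi>]
    by (intro bij_betwI[where g = "Hmap \<H> n (Y, B) (X, A) \<psi>"]) auto
qed

end

section \<open>Cylinders and double mapping cylinders\<close>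

abbreviation decode :: "'u \<Rightarrow> 'u \<times> real" where
  "decode \<equiv> inv_into UNIV encode"

abbreviation base :: "'u \<Rightarrow> 'u" where
  "base \<equiv> fst \<circ> decode"

abbreviation height :: "'u \<Rightarrow> real" where
  "height \<equiv> snd \<circ> decode"

lemma double_cyl_iff:
  "(x, t) \<in> double_cyl S1 S2 \<longleftrightarrow> 0 \<le> t \<and> t \<le> 1 \<and> (t < 1 \<longrightarrow> x \<in> S1) \<and> (0 < t \<longrightarrow> x \<in> S2)"
  by (auto simp: double_cyl_def)

text \<open>\<open>subpair Z (N, B)\<close> is the pair \<open>(N, B)\<close> with the topologies induced by an ambient space \<open>Z\<close>;
  keeping \<open>Z\<close> fixed turns statements about pairs into inclusions of sets.\<close>
lemma is_pair_subpair: "snd Q \<subseteq> fst Q \<Longrightarrow> snd Q \<subseteq> topspace Z \<Longrightarrow> is_pair (subpair Z Q)"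
  by (simp add: is_pair_def subpair_def)

lemma pair_map_subpair:
  assumes "continuous_map Z Z' \<Phi>" "\<Phi> ` (topspace Z \<inter> fst Q) \<subseteq> fst Q'" "\<Phi> ` snd Q \<subseteq> snd Q'"
  shows "pair_map (subpair Z Q) (subpair Z' Q') \<Phi>"
  using assms
  by (auto simp: pair_map_def subpair_def continuous_map_in_subtopology continuous_map_from_subtopology)

lemma subtopology_in_subpair: "B \<subseteq> N \<Longrightarrow> subtopology (subtopology Z N) B = subtopology Z B"
  by (simp add: subtopology_subtopology Int_absorb1)

locale cohomology_with_cylinders = cohomology_theory K \<H>
  for K :: "'k ring" and \<H> :: "('u, 'k, 'v) cohomology" +
  assumes universe: "\<exists>e :: 'u \<times> real \<Rightarrow> 'u. inj e"
begin

lemma inj_encode: "inj (encode :: 'u \<times> real \<Rightarrow> 'u)"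
  unfolding encode_def using universe by (rule someI_ex)

lemma decode_encode [simp]: "inv_into UNIV encode (encode p :: 'u) = p"
  using inj_encode by simp

lemma encode_eq_iff [simp]: "encode p = (encode q :: 'u) \<longleftrightarrow> p = q"
  using inj_encode by (simp add: inj_eq)

lemma encode_in_image_iff [simp]: "encode p \<in> encode ` W \<longleftrightarrow> p \<in> W" for p :: "'u \<times> real"
  using inj_encode by (simp add: inj_image_mem_iff)

lemma topspace_cylinder: "topspace (cylinder X :: 'u topology) = encode ` (topspace X \<times> {0..1})"
  by (force simp: cylinder_def encoded_def topspace_pullback_topology)

lemma continuous_decode:
  "continuous_map (cylinder X :: 'u topology) (prod_topology X (top_of_set {0..1})) decode"
  using continuous_map_pullback[OF continuous_map_id]
  unfolding cylinder_def encoded_def by (simp add: o_def)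

lemma continuous_base: "continuous_map (cylinder X :: 'u topology) X base"
  using continuous_map_compose[OF continuous_decode continuous_map_fst] .

lemma continuous_height: "continuous_map (cylinder X :: 'u topology) euclideanreal height"
  using continuous_map_compose[OF continuous_decode continuous_map_snd]
  by (simp add: continuous_map_in_subtopology)

text \<open>The universal property of the product, transported along \<open>encode\<close>.\<close>
lemma continuous_into_cylinder:
  fixes \<alpha> :: "'a \<Rightarrow> 'u"
  assumes "continuous_map T X \<alpha>" "continuous_map T euclideanreal \<tau>"
    and "\<And>z. z \<in> topspace T \<Longrightarrow> \<tau> z \<in> {0..1}"
  shows "continuous_map T (cylinder X) (\<lambda>z. encode (\<alpha> z, \<tau> z))"
  unfolding cylinder_def encoded_def
proof (rule continuous_map_pullback')
  show "continuous_map T (prod_topology X (top_of_set {0..1})) (decode \<circ> (\<lambda>z. encode (\<alpha> z, \<tau> z)))"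
    using assms by (auto simp: o_def continuous_map_pairwise continuous_map_in_subtopology)
qed auto

lemma openin_cylinder:
  assumes "openin X U" "open V"
  shows "openin (cylinder X :: 'u topology) {z \<in> topspace (cylinder X). base z \<in> U \<and> height z \<in> V}"
proof -
  have "openin (cylinder X) {z \<in> topspace (cylinder X). base z \<in> U}"
    using openin_continuous_map_preimage[OF continuous_base assms(1)] .
  moreover have "openin (cylinder X) {z \<in> topspace (cylinder X). height z \<in> V}"
    using openin_continuous_map_preimage[OF continuous_height] assms(2) by simp
  ultimately have "openin (cylinder X) ({z \<in> topspace (cylinder X). base z \<in> U} \<inter>
      {z \<in> topspace (cylinder X). height z \<in> V})"
    by (rule openin_Int)
  then show ?thesis by (rule back_subst[where P = "openin (cylinder X)"]) auto
qed

text \<open>Excision of \<open>N - M\<close>: it is closed in \<open>N\<close> and \<open>B\<close> is open, so closure and interior change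
  nothing.\<close>
lemma excision_subpair:
  assumes "N \<subseteq> topspace Z" "openin (subtopology Z N) M" "openin (subtopology Z N) B" "N - M \<subseteq> B"
  shows "Hiso \<H> n (subpair Z (M, M \<inter> B)) (subpair Z (N, B)) id"
proof -
  have MB: "M \<subseteq> N" "B \<subseteq> N" using assms(2,3) openin_subset by fastforce+
  have top: "topspace (subtopology Z N) = N" using assms(1) by auto
  have "closedin (subtopology Z N) (N - M)" using assms(2) top by (metis closedin_diff closedin_topspace)
  then have "subtopology Z N closure_of (N - M) = N - M" by (simp add: closure_of_closedin)
  moreover have "subtopology Z N interior_of B = B" using assms(3) by (simp add: interior_of_openin)
  moreover have "is_pair (subtopology Z N, B)" using MB top by (simp add: is_pair_def)
  ultimately have "Hiso \<H> n (subtopology (subtopology Z N) (topspace (subtopology Z N) - (N - M)), B - (N - M))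
      (subtopology Z N, B) id"
    using assms(4) by (intro excision) auto
  moreover have "N - (N - M) = M" "B - (N - M) = M \<inter> B" using MB by auto
  moreover have "N \<inter> M = M" using MB by auto
  ultimately show ?thesis
    unfolding top by (simp add: subpair_def subtopology_subtopology)
qed

text \<open>A part \<open>W\<close> of the cylinder that is star-shaped in the vertical direction around the level \<open>\<tau>\<close>
  is contracted to its base by moving the height linearly to \<open>\<tau>\<close>.\<close>
lemma Hiso_contraction:
  assumes W: "W \<subseteq> topspace X \<times> {0..1}" and \<tau>: "\<tau> \<in> {0..1}"
    and star: "\<And>x t l. (x, t) \<in> W \<Longrightarrow> l \<in> {0..1} \<Longrightarrow> (x, l * t + (1 - l) * \<tau>) \<in> W"
  shows "Hiso \<H> n (subtopology (cylinder X) (encode ` W), {}) (subtopology X (fst ` W), {}) base"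
proof (rule Hiso_homotopy_equivalence)
  let ?Z = "subtopology (cylinder X) (encode ` W) :: 'u topology" and ?\<psi> = "\<lambda>x. encode (x, \<tau>) :: 'u"
  have top: "topspace ?Z = encode ` W" using W by (auto simp: topspace_cylinder)
  have \<tau>W: "(x, \<tau>) \<in> W" if "(x, t) \<in> W" for x t using star[OF that, of 0] by simp
  show 1: "pair_map (?Z, {}) (subtopology X (fst ` W), {}) base"
    using continuous_base by (force simp: continuous_map_in_subtopology continuous_map_from_subtopology top)
  show 2: "pair_map (subtopology X (fst ` W), {}) (?Z, {}) ?\<psi>"
    using \<tau>W \<tau> by (force simp: continuous_map_in_subtopology intro!: continuous_into_cylinder
        continuous_map_from_subtopology)
  have "continuous_map (subtopology X (fst ` W)) (subtopology X (fst ` W)) id"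
    by (simp add: continuous_map_from_subtopology continuous_map_in_subtopology)
  moreover have "base \<circ> ?\<psi> = id" by auto
  ultimately show "homotopic_with (\<lambda>\<kappa>. \<kappa> ` {} \<subseteq> {}) (subtopology X (fst ` W)) (subtopology X (fst ` W)) (base \<circ> ?\<psi>) id"
    by simp
  let ?I = "top_of_set {0..1::real}"
  let ?h = "\<lambda>(l, z). encode (base z, l * height z + (1 - l) * \<tau>) :: 'u"
  have inW: "(base z, l * height z + (1 - l) * \<tau>) \<in> W" if "l \<in> {0..1}" "z \<in> encode ` W" for l z
    using that star by auto
  have bh: "continuous_map (prod_topology ?I ?Z) X (base \<circ> snd)"
    "continuous_map (prod_topology ?I ?Z) euclideanreal (height \<circ> snd)"
    using continuous_map_compose[OF continuous_map_snd continuous_map_from_subtopology[OF continuous_base]]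
      continuous_map_compose[OF continuous_map_snd continuous_map_from_subtopology[OF continuous_height]]
    by blast+
  have l: "continuous_map (prod_topology ?I ?Z) euclideanreal fst"
    using continuous_map_fst[of ?I ?Z] by (simp add: continuous_map_in_subtopology)
  have "continuous_map (prod_topology ?I ?Z) (cylinder X)
      (\<lambda>p. encode ((base \<circ> snd) p, fst p * (height \<circ> snd) p + (1 - fst p) * \<tau>))"
  proof (rule continuous_into_cylinder)
    show "fst p * (height \<circ> snd) p + (1 - fst p) * \<tau> \<in> {0..1}" if "p \<in> topspace (prod_topology ?I ?Z)" for p
    proof -
      have "(base (snd p), fst p * height (snd p) + (1 - fst p) * \<tau>) \<in> W"
        using that by (intro inW) (auto simp: top)
      then show ?thesis using W by auto
    qed
  qed (intro bh l continuous_intros continuous_map_real_mult continuous_map_add continuous_map_diff)+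
  then have "continuous_map (prod_topology ?I ?Z) (cylinder X) ?h" by (simp add: case_prod_unfold)
  moreover have "?h \<in> topspace (prod_topology ?I ?Z) \<rightarrow> encode ` W"
    unfolding topspace_prod_topology top using star by fastforce
  ultimately have "continuous_map (prod_topology ?I ?Z) ?Z ?h"
    by (simp add: continuous_map_in_subtopology image_subset_iff_funcset)
  moreover have "?h (0, z) = (?\<psi> \<circ> base) z" for z by simp
  moreover have "?h (1, z) = id z" if "z \<in> topspace ?Z" for z using that unfolding top by auto
  ultimately show "homotopic_with (\<lambda>\<kappa>. \<kappa> ` {} \<subseteq> {}) ?Z ?Z (?\<psi> \<circ> base) id"
    by (intro iffD2[OF homotopic_with] exI[of _ ?h] conjI ballI) simp_all
qed simp_all

lemma Hiso_subpair:
  assumes "is_pair (subpair Z (N, B))" "is_pair (subpair X (S, A))" "B \<subseteq> N" "A \<subseteq> S"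
    and "pair_map (subpair Z (N, B)) (subpair X (S, A)) \<phi>"
    and "\<And>m. Hiso \<H> m (subtopology Z N, {}) (subtopology X S, {}) \<phi>"
    and "\<And>m. Hiso \<H> m (subtopology Z B, {}) (subtopology X A, {}) \<phi>"
  shows "Hiso \<H> n (subpair Z (N, B)) (subpair X (S, A)) \<phi>"
  using Hiso_pair[of "subtopology Z N" B "subtopology X S" A \<phi> n] assms
  by (simp add: subpair_def subtopology_in_subpair)

lemma Hiso_total_subpair:
  assumes "is_pair (subpair Z (N, B))" "is_pair (subpair X (S, A))" "B \<subseteq> N" "A \<subseteq> S"
    and "pair_map (subpair Z (N, B)) (subpair X (S, A)) \<phi>"
    and "\<And>m. Hiso \<H> m (subpair Z (N, B)) (subpair X (S, A)) \<phi>"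
    and "\<And>m. Hiso \<H> m (subtopology Z B, {}) (subtopology X A, {}) \<phi>"
  shows "Hiso \<H> n (subtopology Z N, {}) (subtopology X S, {}) \<phi>"
  using Hiso_total[of "subtopology Z N" B "subtopology X S" A \<phi> n] assms
  by (simp add: subpair_def subtopology_in_subpair)

text \<open>Let \<open>N\<close> be the double mapping cylinder, \<open>N1\<close> and \<open>N2\<close> its open parts below height 1 and above
  height 0, and \<open>N12\<close> their intersection.  They contract to \<open>X1\<close>, \<open>X2\<close> and \<open>X1 \<inter> X2\<close>, so
  \<open>(N1, N12)\<close> has the cohomology of \<open>(X1, X1 \<inter> X2)\<close>.  Excision replaces these pairs by \<open>(N, N2)\<close>
  and \<open>(X1 \<union> X2, X2)\<close>, and the five lemma passes from there to \<open>N\<close> and \<open>X1 \<union> X2\<close>.\<close>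
lemma Hiso_double_cyl_absolute:
  assumes X: "openin X X1" "openin X X2"
  shows "Hiso \<H> n (subtopology (cylinder X) (encode ` double_cyl X1 X2), {})
    (subtopology X (X1 \<union> X2), {}) base"
proof -
  define Z :: "'u topology" where "Z = cylinder X"
  define N N1 N2 N12 :: "'u set" where "N = encode ` double_cyl X1 X2"
    and "N1 = encode ` {p \<in> double_cyl X1 X2. snd p < 1}"
    and "N2 = encode ` {p \<in> double_cyl X1 X2. 0 < snd p}"
    and "N12 = encode ` ((X1 \<inter> X2) \<times> {0<..<1})"
  have sub: "X1 \<subseteq> topspace X" "X2 \<subseteq> topspace X" using X openin_subset by blast+
  have topZ: "topspace Z = encode ` (topspace X \<times> {0..1})" by (simp add: Z_def topspace_cylinder)
  have NZ: "N \<subseteq> topspace Z" using sub by (auto simp: N_def topZ double_cyl_def)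
  have incl: "N1 \<subseteq> N" "N2 \<subseteq> N" and N12: "N12 = N1 \<inter> N2" and N12': "N - N1 \<subseteq> N2"
    by (auto simp: N_def N1_def N2_def N12_def double_cyl_iff)
  have op: "openin (subtopology Z N) N1" "openin (subtopology Z N) N2"
  proof -
    have "N1 = N \<inter> {z \<in> topspace Z. base z \<in> topspace X \<and> height z \<in> {..<1}}"
      using NZ by (auto simp: N1_def N_def topZ)
    then show "openin (subtopology Z N) N1"
      using openin_cylinder[of X "topspace X" "{..<1}"] by (auto simp: openin_subtopology Z_def)
    have "N2 = N \<inter> {z \<in> topspace Z. base z \<in> topspace X \<and> height z \<in> {0<..}}"
      using NZ by (auto simp: N2_def N_def topZ)
    then show "openin (subtopology Z N) N2"
      using openin_cylinder[of X "topspace X" "{0<..}"] by (auto simp: openin_subtopology Z_def)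
  qed
  \<comment> \<open>The three pieces contract to the levels 0, 1 and 1/2.\<close>
  have conv: "l * t + (1 - l) * s < r" if "l \<in> {0..1}" "t < r" "s < r" for l t s r :: real
    using that convex_bound_lt[of t r s l "1 - l"] by auto
  have conv': "r < l * t + (1 - l) * s" if "l \<in> {0..1}" "r < t" "r < s" for l t s r :: real
    using conv[of l "- t" "- r" "- s"] that by (simp add: algebra_simps)
  have conv01: "l * t + (1 - l) * s \<in> {0..1}" if "l \<in> {0..1}" "t \<in> {0..1}" "s \<in> {0..1}" for l t s :: real
    using that convex_bound_le[of t 1 s l "1 - l"] by auto
  have "fst ` {p \<in> double_cyl X1 X2. snd p < 1} = X1" by (force simp: double_cyl_def)
  then have 1: "Hiso \<H> m (subtopology Z N1, {}) (subtopology X X1, {}) base" for m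
    using Hiso_contraction[of "{p \<in> double_cyl X1 X2. snd p < 1}" X 0 m] sub conv01[of _ _ 0] conv[of _ _ 1 0]
    unfolding N1_def Z_def by (force simp: double_cyl_iff zero_less_mult_iff)
  have "fst ` {p \<in> double_cyl X1 X2. 0 < snd p} = X2" by (force simp: double_cyl_def)
  then have 2: "Hiso \<H> m (subtopology Z N2, {}) (subtopology X X2, {}) base" for m
    using Hiso_contraction[of "{p \<in> double_cyl X1 X2. 0 < snd p}" X 1 m] sub conv01[of _ _ 1] conv'[of _ 0 _ 1]
    unfolding N2_def Z_def by (force simp: double_cyl_iff)
  have "fst ` ((X1 \<inter> X2) \<times> {0<..<1::real}) = X1 \<inter> X2" by (force simp: image_iff intro: bexI[of _ "1/2"])
  moreover have "(X1 \<inter> X2) \<times> {0<..<1} \<subseteq> topspace X \<times> {0..1::real}" using sub by auto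
  ultimately have 12: "Hiso \<H> m (subtopology Z N12, {}) (subtopology X (X1 \<inter> X2), {}) base" for m
    using Hiso_contraction[of "(X1 \<inter> X2) \<times> {0<..<1::real}" X "1/2" m] sub conv[of _ _ 1 "1/2"] conv'[of _ 0 _ "1/2"]
    unfolding N12_def Z_def by auto
  have b: "continuous_map Z X base" by (simp add: Z_def continuous_base)
  have pairs: "is_pair (subpair Z (N1, N12))" "is_pair (subpair Z (N, N2))"
    "is_pair (subpair X (X1, X1 \<inter> X2))" "is_pair (subpair X (X1 \<union> X2, X2))"
    using incl N12 NZ sub by (intro is_pair_subpair; auto)+
  have im: "z \<in> N1 \<Longrightarrow> base z \<in> X1" "z \<in> N2 \<Longrightarrow> base z \<in> X2" "z \<in> N \<Longrightarrow> base z \<in> X1 \<union> X2" for z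
    by (auto simp: N1_def N2_def N_def double_cyl_iff)
  have pmb: "pair_map (subpair Z (N1, N12)) (subpair X (X1, X1 \<inter> X2)) base"
    by (rule pair_map_subpair[OF b]) (unfold image_subset_iff fst_conv snd_conv, use im N12 incl in auto)+
  have pmb': "pair_map (subpair Z (N, N2)) (subpair X (X1 \<union> X2, X2)) base"
    by (rule pair_map_subpair[OF b]) (unfold image_subset_iff fst_conv snd_conv, use im incl in auto)+
  have pmi: "pair_map (subpair Z (N1, N12)) (subpair Z (N, N2)) id"
    by (rule pair_map_subpair) (use incl N12 in auto)
  have pmi': "pair_map (subpair X (X1, X1 \<inter> X2)) (subpair X (X1 \<union> X2, X2)) id"
    by (rule pair_map_subpair) auto
  note pm = pmb pmb' pmi pmi'
  have rel: "Hiso \<H> m (subpair Z (N, N2)) (subpair X (X1 \<union> X2, X2)) base" for m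
  proof (rule Hiso_cancel_left)
    have "Hiso \<H> m (subpair Z (N1, N12)) (subpair X (X1, X1 \<inter> X2)) base"
      by (rule Hiso_subpair[OF pairs(1,3) _ _ pmb 1 12]) (simp_all add: N12)
    moreover have "Hiso \<H> m (subpair X (X1, X1 \<inter> X2)) (subpair X (X1 \<union> X2, X2)) id"
    proof (rule excision_subpair)
      show "openin (subtopology X (X1 \<union> X2)) X1" "openin (subtopology X (X1 \<union> X2)) X2"
        using X by (simp_all add: openin_open_subtopology openin_Un)
    qed (use sub in auto)
    ultimately have "Hiso \<H> m (subpair Z (N1, N12)) (subpair X (X1 \<union> X2, X2)) (id \<circ> base)"
      by (intro Hiso_comp[OF pairs(1,3,4) pmb pmi'])
    then show "Hiso \<H> m (subpair Z (N1, N12)) (subpair X (X1 \<union> X2, X2)) (base \<circ> id)" by (simp add: o_def)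
    show "Hiso \<H> m (subpair Z (N1, N12)) (subpair Z (N, N2)) id"
      using excision_subpair[OF NZ op N12'] N12 by simp
  qed (use pairs pm in auto)
  show ?thesis
    unfolding N_def[symmetric] Z_def[symmetric]
    by (rule Hiso_total_subpair[OF pairs(2,4) _ _ pmb' rel 2]) (use incl in auto)
qed

lemma Hiso_double_cyl:
  assumes X: "openin X X1" "openin X X2" and A: "openin X A1" "openin X A2" "A1 \<subseteq> X1" "A2 \<subseteq> X2"
  shows "Hiso \<H> n (subpair (cylinder X) (encode ` double_cyl X1 X2, encode ` double_cyl A1 A2))
    (subpair X (X1 \<union> X2, A1 \<union> A2)) base"
proof -
  have sub: "X1 \<subseteq> topspace X" "X2 \<subseteq> topspace X" using X openin_subset by blast+
  have BN: "encode ` double_cyl A1 A2 \<subseteq> (encode ` double_cyl X1 X2 :: 'u set)"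
    "encode ` double_cyl X1 X2 \<subseteq> topspace (cylinder X :: 'u topology)"
    using A sub by (auto simp: double_cyl_def topspace_cylinder)
  have pairs: "is_pair (subpair (cylinder X) (encode ` double_cyl X1 X2, encode ` double_cyl A1 A2 :: 'u set))"
    "is_pair (subpair X (X1 \<union> X2, A1 \<union> A2))"
    by (rule is_pair_subpair; use BN A sub in \<open>unfold fst_conv snd_conv, blast\<close>)+
  have pm: "pair_map (subpair (cylinder X) (encode ` double_cyl X1 X2, encode ` double_cyl A1 A2 :: 'u set))
      (subpair X (X1 \<union> X2, A1 \<union> A2)) base"
    by (rule pair_map_subpair[OF continuous_base]) (auto simp: double_cyl_def)
  show ?thesis
    by (rule Hiso_subpair[OF pairs BN(1) _ pm Hiso_double_cyl_absolute[OF X] Hiso_double_cyl_absolute[OF A(1,2)]])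
      (use A in auto)
qed

end

section \<open>Naturality of the Mayer--Vietoris differential\<close>

text \<open>A square is read with \<open>L\<close> and \<open>M\<close> horizontal and \<open>s\<close> and \<open>t\<close> vertical; membership in \<open>B\<close> is part of
  the definition so that squares can be pasted without side conditions.\<close>
definition commuting_square ::
    "'a set \<Rightarrow> 'b set \<Rightarrow> ('a \<Rightarrow> 'b) \<Rightarrow> ('a \<Rightarrow> 'c) \<Rightarrow> ('b \<Rightarrow> 'd) \<Rightarrow> ('c \<Rightarrow> 'd) \<Rightarrow> bool" where
  "commuting_square A B L s t M \<longleftrightarrow> (\<forall>a\<in>A. L a \<in> B \<and> M (s a) = t (L a))"

lemma commuting_square_comp:
  "commuting_square A B L s t M \<Longrightarrow> commuting_square B C L' t r M'
    \<Longrightarrow> commuting_square A C (L' \<circ> L) s r (M' \<circ> M)"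
  by (auto simp: commuting_square_def)

text \<open>A natural bijection has a natural inverse.  The lower map is inverted on its image only, so
  injectivity suffices there.\<close>
lemma commuting_square_inverse:
  assumes "commuting_square A B L s t M" "bij_betw L A B" "inj_on M C" "s ` A \<subseteq> C"
  shows "commuting_square B A (inv_into A L) t s (inv_into C M)"
  unfolding commuting_square_def
proof
  fix b assume "b \<in> B"
  then have b: "inv_into A L b \<in> A" "L (inv_into A L b) = b"
    using assms(2) by (auto simp: bij_betw_def intro: inv_into_into f_inv_into_f)
  moreover have "inv_into C M (t b) = s (inv_into A L b)"
    by (rule inv_into_f_eq[OF assms(3)]) (use assms(1,4) b in \<open>auto simp: commuting_square_def\<close>)
  ultimately show "inv_into A L b \<in> A \<and> inv_into C M (t b) = s (inv_into A L b)" by blast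
qed

definition open_pair :: "'u topology \<Rightarrow> 'u set \<times> 'u set \<Rightarrow> bool" where
  "open_pair X P \<longleftrightarrow> openin X (fst P) \<and> openin X (snd P) \<and> snd P \<subseteq> fst P"

text \<open>The pieces of the double mapping cylinder that enter the differential; \<open>N\<close> is the cylinder of
  the spaces and \<open>B\<close> that of the subspaces.\<close>

definition lower :: "'u set" where "lower = encode ` (UNIV \<times> {..<1/3})"
definition upper :: "'u set" where "upper = encode ` (UNIV \<times> {2/3<..})"
definition middle :: "'u set \<Rightarrow> 'u set" where "middle N = N \<inter> encode ` (UNIV \<times> {0<..<1})"
definition ends :: "'u set \<Rightarrow> 'u set \<Rightarrow> 'u set" where
  "ends N B = middle N \<inter> (lower \<union> upper \<union> B)"
definition lower_end :: "'u set \<Rightarrow> 'u set \<Rightarrow> 'u set" where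
  "lower_end N B = middle N \<inter> (lower \<union> B)"
definition collar :: "'u set \<Rightarrow> 'u set \<Rightarrow> 'u set" where
  "collar N B = N \<inter> (lower \<union> upper) \<union> B"

text \<open>The differential as a chain of seven maps, bracketed so that the squares can be pasted from
  right to left.\<close>
lemma mv_differential_eq:
  assumes "N = encode ` double_cyl (fst P1) (fst P2)" "B = encode ` double_cyl (snd P1) (snd P2)"
    and "Z = cylinder X" "J = subpair X (fst P1 \<union> fst P2, snd P1 \<union> snd P2)"
    and "I = subpair X (fst P1 \<inter> fst P2, snd P1 \<inter> snd P2)"
  shows "mv_differential \<H> n X P1 P2 =
    inv_into (carrier (Hgrp \<H> n J)) (Hmap \<H> n (subpair Z (N, B)) J base) \<circ>
    (Hmap \<H> n (subpair Z (N, B)) (subpair Z (N, collar N B)) id \<circ>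
    (inv_into (carrier (Hgrp \<H> n (subpair Z (N, collar N B))))
      (Hmap \<H> n (subpair Z (middle N, ends N B)) (subpair Z (N, collar N B)) id) \<circ>
    (Hdelta \<H> (n - 1) (subpair Z (middle N, ends N B)) \<circ>
    (Hmap \<H> (n - 1) (subpair Z (ends N B, {})) (subpair Z (ends N B, lower_end N B)) id \<circ>
    (inv_into (carrier (Hgrp \<H> (n - 1) (subpair Z (ends N B, lower_end N B))))
      (Hmap \<H> (n - 1) (subpair Z (middle N \<inter> upper, middle N \<inter> B \<inter> upper))
        (subpair Z (ends N B, lower_end N B)) id) \<circ>
    Hmap \<H> (n - 1) (subpair Z (middle N \<inter> upper, middle N \<inter> B \<inter> upper)) I base)))))"
  unfolding assms mv_differential_def Let_def lower_def upper_def middle_def ends_def lower_end_def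
    collar_def
  by (simp add: comp_assoc)

context cohomology_with_cylinders
begin

lemma Hmap_commuting_square:
  assumes "is_pair Q" "is_pair R" "is_pair Q'" "is_pair R'"
    and "pair_map Q R \<psi>" "pair_map Q' R' \<psi>'" "pair_map R R' \<sigma>" "pair_map Q Q' \<tau>"
    and "\<And>x. x \<in> topspace (fst Q) \<Longrightarrow> \<sigma> (\<psi> x) = \<psi>' (\<tau> x)"
  shows "commuting_square (carrier (Hgrp \<H> n R')) (carrier (Hgrp \<H> n Q')) (Hmap \<H> n Q' R' \<psi>')
    (Hmap \<H> n R R' \<sigma>) (Hmap \<H> n Q Q' \<tau>) (Hmap \<H> n Q R \<psi>)"
  unfolding commuting_square_def
  by (intro ballI conjI Hmap_closed Hmap_square) (use assms in auto)

lemma Hmap_inverse_commuting_square: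
  assumes "is_pair Q" "is_pair R" "is_pair Q'" "is_pair R'"
    and "pair_map Q R \<psi>" "pair_map Q' R' \<psi>'" "pair_map R R' \<sigma>" "pair_map Q Q' \<tau>"
    and "\<And>x. x \<in> topspace (fst Q) \<Longrightarrow> \<sigma> (\<psi> x) = \<psi>' (\<tau> x)"
    and "Hiso \<H> n Q R \<psi>" "Hiso \<H> n Q' R' \<psi>'"
  shows "commuting_square (carrier (Hgrp \<H> n Q')) (carrier (Hgrp \<H> n R'))
    (inv_into (carrier (Hgrp \<H> n R')) (Hmap \<H> n Q' R' \<psi>')) (Hmap \<H> n Q Q' \<tau>) (Hmap \<H> n R R' \<sigma>)
    (inv_into (carrier (Hgrp \<H> n R)) (Hmap \<H> n Q R \<psi>))"
proof (rule commuting_square_inverse)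
  show "Hmap \<H> n R R' \<sigma> ` carrier (Hgrp \<H> n R') \<subseteq> carrier (Hgrp \<H> n R)"
    using Hmap_closed[OF assms(2,4,7)] by auto
qed (use assms Hmap_commuting_square in \<open>auto simp: Hiso_def bij_betw_def\<close>)

lemma Hdelta_commuting_square:
  assumes "is_pair (X, A)" "is_pair (Y, B)" "pair_map (X, A) (Y, B) \<phi>"
  shows "commuting_square (carrier (Hgrp \<H> n (subtopology Y B, {}))) (carrier (Hgrp \<H> (n + 1) (Y, B)))
    (Hdelta \<H> n (Y, B)) (Hmap \<H> n (subtopology X A, {}) (subtopology Y B, {}) \<phi>)
    (Hmap \<H> (n + 1) (X, A) (Y, B) \<phi>) (Hdelta \<H> n (X, A))"
  using Hdelta_linear[OF assms(2), of n] Hdelta_natural[OF assms, of _ n]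
  by (auto simp: commuting_square_def linear_maps_def)

text \<open>The three maps that the differential inverts are bijective: the first two by excision, the last
  one by comparison of the double mapping cylinder with the union.\<close>
lemma mv_pieces:
  assumes P: "open_pair X P1" "open_pair X P2"
    and N: "N = encode ` double_cyl (fst P1) (fst P2)" and B: "B = encode ` double_cyl (snd P1) (snd P2)"
    and Z: "Z = (cylinder X :: 'u topology)"
  shows "N \<subseteq> topspace Z" "B \<subseteq> N"
    and "Hiso \<H> n (subpair Z (middle N \<inter> upper, middle N \<inter> B \<inter> upper)) (subpair Z (ends N B, lower_end N B)) id"
    and "Hiso \<H> n (subpair Z (middle N, ends N B)) (subpair Z (N, collar N B)) id"
    and "Hiso \<H> n (subpair Z (N, B)) (subpair X (fst P1 \<union> fst P2, snd P1 \<union> snd P2)) base"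
proof -
  have sub: "fst P1 \<subseteq> topspace X" "fst P2 \<subseteq> topspace X" "snd P1 \<subseteq> fst P1" "snd P2 \<subseteq> fst P2"
    using P openin_subset by (auto simp: open_pair_def)
  have op: "openin X (snd P1 \<inter> snd P2)" using P by (auto simp: open_pair_def)
  show NZ: "N \<subseteq> topspace Z" and BN: "B \<subseteq> N"
    using sub by (auto simp: N B Z double_cyl_def topspace_cylinder)
  \<comment> \<open>Near its two ends \<open>B\<close> need not be open in \<open>N\<close>; there the neighbourhoods \<open>lower\<close> and \<open>upper\<close>
    take over.  The open part of \<open>B\<close> between the ends is cut out by \<open>GA\<close>.\<close>
  define GL GU GM GA where "GL = {z \<in> topspace Z. base z \<in> topspace X \<and> height z \<in> {..<1/3}}"
    and "GU = {z \<in> topspace Z. base z \<in> topspace X \<and> height z \<in> {2/3<..}}"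
    and "GM = {z \<in> topspace Z. base z \<in> topspace X \<and> height z \<in> {0<..<1}}"
    and "GA = {z \<in> topspace Z. base z \<in> snd P1 \<inter> snd P2 \<and> height z \<in> {0<..<1}}"
  have G: "openin Z GL" "openin Z GU" "openin Z GM" "openin Z GA"
    unfolding GL_def GU_def GM_def GA_def Z
    by (rule openin_cylinder; simp add: op open_greaterThanLessThan)+
  have mem: "encode (x, t) \<in> GL \<longleftrightarrow> x \<in> topspace X \<and> 0 \<le> t \<and> t \<le> 1 \<and> t < 1/3"
    "encode (x, t) \<in> GU \<longleftrightarrow> x \<in> topspace X \<and> 0 \<le> t \<and> t \<le> 1 \<and> 2/3 < t"
    "encode (x, t) \<in> GM \<longleftrightarrow> x \<in> topspace X \<and> 0 < t \<and> t < 1"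
    "encode (x, t) \<in> GA \<longleftrightarrow> x \<in> snd P1 \<inter> snd P2 \<and> 0 < t \<and> t < 1"
    "encode (x, t) \<in> N \<longleftrightarrow> 0 \<le> t \<and> t \<le> 1 \<and> (t < 1 \<longrightarrow> x \<in> fst P1) \<and> (0 < t \<longrightarrow> x \<in> fst P2)"
    "encode (x, t) \<in> B \<longleftrightarrow> 0 \<le> t \<and> t \<le> 1 \<and> (t < 1 \<longrightarrow> x \<in> snd P1) \<and> (0 < t \<longrightarrow> x \<in> snd P2)"
    "encode (x, t) \<in> lower \<longleftrightarrow> t < 1/3" "encode (x, t) \<in> upper \<longleftrightarrow> 2/3 < t"
    "encode (x, t) \<in> middle N \<longleftrightarrow> encode (x, t) \<in> N \<and> 0 < t \<and> t < 1" for x t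
    using sub by (auto simp: GL_def GU_def GM_def GA_def N B Z topspace_cylinder double_cyl_iff lower_def
        upper_def middle_def)
  have eqI: "U = V" if "U \<subseteq> topspace Z" "V \<subseteq> topspace Z"
    "\<And>x t. x \<in> topspace X \<Longrightarrow> 0 \<le> t \<Longrightarrow> t \<le> 1 \<Longrightarrow> encode (x, t) \<in> U \<longleftrightarrow> encode (x, t) \<in> V" for U V
    using that by (auto simp: Z topspace_cylinder set_eq_iff subset_iff image_iff Ball_def)
  have pieces: "middle N \<subseteq> N" "ends N B \<subseteq> middle N" "collar N B \<subseteq> N" "lower_end N B \<subseteq> ends N B"
    "middle N \<inter> upper \<subseteq> ends N B"
    using BN by (auto simp: middle_def ends_def collar_def lower_end_def)
  have Int: "openin (subtopology Z S) V" if "openin Z U" "V = S \<inter> U" for S U V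
    using that by (auto simp: openin_subtopology)
  have mid: "openin (subtopology Z N) (middle N)"
    by (rule Int[OF G(3)], rule eqI) (use NZ pieces sub in \<open>auto simp: mem\<close>)
  have col: "openin (subtopology Z N) (collar N B)"
    by (rule Int[OF openin_Un[OF openin_Un[OF G(1,2)] G(4)]], rule eqI)
      (use NZ pieces sub in \<open>auto simp: mem collar_def\<close>)
  have up: "openin (subtopology Z (ends N B)) (middle N \<inter> upper)"
    by (rule Int[OF G(2)], rule eqI) (use NZ pieces sub in \<open>auto simp: mem ends_def\<close>)
  have low: "openin (subtopology Z (ends N B)) (lower_end N B)"
    by (rule Int[OF openin_Un[OF G(1) G(4)]], rule eqI)
      (use NZ pieces sub in \<open>auto simp: mem ends_def lower_end_def\<close>)
  have "middle N \<inter> upper \<inter> lower_end N B = middle N \<inter> B \<inter> upper"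
    by (rule eqI) (use NZ pieces sub in \<open>auto simp: mem lower_end_def\<close>)
  moreover have "ends N B - middle N \<inter> upper \<subseteq> lower_end N B" by (auto simp: ends_def lower_end_def)
  ultimately show "Hiso \<H> n (subpair Z (middle N \<inter> upper, middle N \<inter> B \<inter> upper))
      (subpair Z (ends N B, lower_end N B)) id"
    using excision_subpair[OF _ up low] pieces NZ by auto
  have "middle N \<inter> collar N B = ends N B" using pieces by (auto simp: collar_def ends_def)
  moreover have "N - middle N \<subseteq> collar N B"
  proof
    fix z assume z: "z \<in> N - middle N"
    then obtain x t where "z = encode (x, t)" by (auto simp: N)
    then show "z \<in> collar N B" using z by (auto simp: mem collar_def)
  qed
  ultimately show "Hiso \<H> n (subpair Z (middle N, ends N B)) (subpair Z (N, collar N B)) id"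
    using excision_subpair[OF NZ mid col] by auto
  show "Hiso \<H> n (subpair Z (N, B)) (subpair X (fst P1 \<union> fst P2, snd P1 \<union> snd P2)) base"
    using P unfolding N B Z by (intro Hiso_double_cyl) (auto simp: open_pair_def)
qed

lemma mv_pairs:
  assumes P: "open_pair X P1" "open_pair X P2"
    and N: "N = encode ` double_cyl (fst P1) (fst P2)" and B: "B = encode ` double_cyl (snd P1) (snd P2)"
    and Z: "Z = (cylinder X :: 'u topology)"
  shows "is_pair (subpair Z (N, B))" "is_pair (subpair Z (N, collar N B))"
    "is_pair (subpair Z (middle N, ends N B))" "is_pair (subpair Z (ends N B, {}))"
    "is_pair (subpair Z (ends N B, lower_end N B))"
    "is_pair (subpair Z (middle N \<inter> upper, middle N \<inter> B \<inter> upper))"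
    "is_pair (subpair X (fst P1 \<union> fst P2, snd P1 \<union> snd P2))"
    "is_pair (subpair X (fst P1 \<inter> fst P2, snd P1 \<inter> snd P2))"
    "pair_map (subpair Z (N, B)) (subpair X (fst P1 \<union> fst P2, snd P1 \<union> snd P2)) base"
    "pair_map (subpair Z (middle N \<inter> upper, middle N \<inter> B \<inter> upper))
       (subpair X (fst P1 \<inter> fst P2, snd P1 \<inter> snd P2)) base"
    "pair_map (subpair Z (N, B)) (subpair Z (N, collar N B)) id"
    "pair_map (subpair Z (middle N, ends N B)) (subpair Z (N, collar N B)) id"
    "pair_map (subpair Z (ends N B, {})) (subpair Z (ends N B, lower_end N B)) id"
    "pair_map (subpair Z (middle N \<inter> upper, middle N \<inter> B \<inter> upper))
       (subpair Z (ends N B, lower_end N B)) id"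
proof -
  note NB = mv_pieces(1,2)[OF P N B Z]
  have sub: "fst P1 \<subseteq> topspace X" "fst P2 \<subseteq> topspace X" "snd P1 \<subseteq> fst P1" "snd P2 \<subseteq> fst P2"
    using P openin_subset by (auto simp: open_pair_def)
  have c: "continuous_map Z X base" by (simp add: Z continuous_base)
  have pieces: "middle N \<subseteq> N" "ends N B \<subseteq> middle N" "collar N B \<subseteq> N" "lower_end N B \<subseteq> ends N B"
    "middle N \<inter> upper \<subseteq> ends N B" "middle N \<inter> B \<inter> upper \<subseteq> lower_end N B" "B \<subseteq> collar N B" "ends N B \<subseteq> collar N B"
    using NB by (auto simp: middle_def ends_def collar_def lower_end_def)
  show "is_pair (subpair Z (N, B))" "is_pair (subpair Z (N, collar N B))"
    "is_pair (subpair Z (middle N, ends N B))" "is_pair (subpair Z (ends N B, {}))"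
    "is_pair (subpair Z (ends N B, lower_end N B))"
    "is_pair (subpair Z (middle N \<inter> upper, middle N \<inter> B \<inter> upper))"
    "is_pair (subpair X (fst P1 \<union> fst P2, snd P1 \<union> snd P2))"
    "is_pair (subpair X (fst P1 \<inter> fst P2, snd P1 \<inter> snd P2))"
    by (rule is_pair_subpair; use NB pieces sub in \<open>unfold fst_conv snd_conv, blast\<close>)+
  have b: "z \<in> N \<Longrightarrow> base z \<in> fst P1 \<union> fst P2" "z \<in> B \<Longrightarrow> base z \<in> snd P1 \<union> snd P2"
    "z \<in> middle N \<Longrightarrow> base z \<in> fst P1 \<inter> fst P2" "z \<in> middle N \<inter> B \<Longrightarrow> base z \<in> snd P1 \<inter> snd P2" for z
    by (auto simp: N B middle_def double_cyl_iff)
  show "pair_map (subpair Z (N, B)) (subpair X (fst P1 \<union> fst P2, snd P1 \<union> snd P2)) base"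
    by (rule pair_map_subpair[OF c]; unfold fst_conv snd_conv image_subset_iff; use b in blast)
  show "pair_map (subpair Z (middle N \<inter> upper, middle N \<inter> B \<inter> upper))
       (subpair X (fst P1 \<inter> fst P2, snd P1 \<inter> snd P2)) base"
    by (rule pair_map_subpair[OF c]; unfold fst_conv snd_conv image_subset_iff; use b in blast)
  show "pair_map (subpair Z (N, B)) (subpair Z (N, collar N B)) id"
    "pair_map (subpair Z (middle N, ends N B)) (subpair Z (N, collar N B)) id"
    "pair_map (subpair Z (ends N B, {})) (subpair Z (ends N B, lower_end N B)) id"
    "pair_map (subpair Z (middle N \<inter> upper, middle N \<inter> B \<inter> upper))
       (subpair Z (ends N B, lower_end N B)) id"
    by (rule pair_map_subpair[OF continuous_map_id]; use pieces in \<open>unfold fst_conv snd_conv image_id id_apply, blast\<close>)+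
qed

text \<open>A map \<open>\<phi>\<close> of spaces acts on cylinders by \<open>\<phi>\<close> on the base and the identity on heights.  It
  respects all pieces, so each of the seven maps gives a commuting square.\<close>
lemma mv_differential_natural:
  assumes \<phi>: "continuous_map X Y \<phi>"
    and P: "open_pair X P1" "open_pair X P2" and Q: "open_pair Y Q1" "open_pair Y Q2"
    and maps: "\<phi> ` fst P1 \<subseteq> fst Q1" "\<phi> ` snd P1 \<subseteq> snd Q1" "\<phi> ` fst P2 \<subseteq> fst Q2" "\<phi> ` snd P2 \<subseteq> snd Q2"
  shows "commuting_square
    (carrier (Hgrp \<H> (n - 1) (subpair Y (fst Q1 \<inter> fst Q2, snd Q1 \<inter> snd Q2))))
    (carrier (Hgrp \<H> n (subpair Y (fst Q1 \<union> fst Q2, snd Q1 \<union> snd Q2))))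
    (mv_differential \<H> n Y Q1 Q2)
    (Hmap \<H> (n - 1) (subpair X (fst P1 \<inter> fst P2, snd P1 \<inter> snd P2))
      (subpair Y (fst Q1 \<inter> fst Q2, snd Q1 \<inter> snd Q2)) \<phi>)
    (Hmap \<H> n (subpair X (fst P1 \<union> fst P2, snd P1 \<union> snd P2))
      (subpair Y (fst Q1 \<union> fst Q2, snd Q1 \<union> snd Q2)) \<phi>)
    (mv_differential \<H> n X P1 P2)"
proof -
  define Z Z' where "Z = (cylinder X :: 'u topology)" and "Z' = (cylinder Y :: 'u topology)"
  define N B where "N = (encode ` double_cyl (fst P1) (fst P2) :: 'u set)"
    and "B = (encode ` double_cyl (snd P1) (snd P2) :: 'u set)"
  define N' B' where "N' = (encode ` double_cyl (fst Q1) (fst Q2) :: 'u set)"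
    and "B' = (encode ` double_cyl (snd Q1) (snd Q2) :: 'u set)"
  define \<Phi> where "\<Phi> = (\<lambda>z. encode (\<phi> (base z), height z) :: 'u)"
  note X = mv_pairs[OF P N_def B_def Z_def] and X' = mv_pieces[OF P N_def B_def Z_def]
  note Y = mv_pairs[OF Q N'_def B'_def Z'_def] and Y' = mv_pieces[OF Q N'_def B'_def Z'_def]
  have \<Phi>: "continuous_map Z Z' \<Phi>"
    unfolding \<Phi>_def Z_def Z'_def
  proof (rule continuous_into_cylinder)
    show "continuous_map (cylinder X) Y (\<lambda>z. \<phi> (base z))"
      using continuous_map_compose[OF continuous_base \<phi>] by (simp add: o_def)
  qed (use continuous_height in \<open>auto simp: topspace_cylinder o_def\<close>)
  have im: "z \<in> N \<Longrightarrow> \<Phi> z \<in> N'" "z \<in> B \<Longrightarrow> \<Phi> z \<in> B'" "z \<in> lower \<Longrightarrow> \<Phi> z \<in> lower"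
    "z \<in> upper \<Longrightarrow> \<Phi> z \<in> upper" "z \<in> middle N \<Longrightarrow> \<Phi> z \<in> middle N'" for z
    using maps by (auto simp: \<Phi>_def N_def N'_def B_def B'_def lower_def upper_def middle_def double_cyl_iff)
  have im': "z \<in> ends N B \<Longrightarrow> \<Phi> z \<in> ends N' B'" "z \<in> lower_end N B \<Longrightarrow> \<Phi> z \<in> lower_end N' B'"
    "z \<in> collar N B \<Longrightarrow> \<Phi> z \<in> collar N' B'" for z
    using im by (auto simp: ends_def lower_end_def collar_def)
  have \<Phi>p: "pair_map (subpair Z (N, B)) (subpair Z' (N', B')) \<Phi>"
    "pair_map (subpair Z (N, collar N B)) (subpair Z' (N', collar N' B')) \<Phi>"
    "pair_map (subpair Z (middle N, ends N B)) (subpair Z' (middle N', ends N' B')) \<Phi>"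
    "pair_map (subpair Z (ends N B, {})) (subpair Z' (ends N' B', {})) \<Phi>"
    "pair_map (subpair Z (ends N B, lower_end N B)) (subpair Z' (ends N' B', lower_end N' B')) \<Phi>"
    "pair_map (subpair Z (middle N \<inter> upper, middle N \<inter> B \<inter> upper))
      (subpair Z' (middle N' \<inter> upper, middle N' \<inter> B' \<inter> upper)) \<Phi>"
    by (rule pair_map_subpair[OF \<Phi>]; unfold fst_conv snd_conv image_subset_iff; use im im' in blast)+
  have \<phi>p: "pair_map (subpair X (fst P1 \<union> fst P2, snd P1 \<union> snd P2)) (subpair Y (fst Q1 \<union> fst Q2, snd Q1 \<union> snd Q2)) \<phi>"
    "pair_map (subpair X (fst P1 \<inter> fst P2, snd P1 \<inter> snd P2)) (subpair Y (fst Q1 \<inter> fst Q2, snd Q1 \<inter> snd Q2)) \<phi>"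
    by (rule pair_map_subpair[OF \<phi>]; unfold fst_conv snd_conv; use maps in blast)+
  have b: "\<phi> (base z) = base (\<Phi> z)" for z by (simp add: \<Phi>_def)
  have "subtopology (subtopology Z (middle N)) (ends N B) = subtopology Z (ends N B)"
    "subtopology (subtopology Z' (middle N')) (ends N' B') = subtopology Z' (ends N' B')"
    by (rule subtopology_in_subpair; auto simp: ends_def)+
  then have delta: "commuting_square (carrier (Hgrp \<H> (n - 1) (subpair Z' (ends N' B', {}))))
      (carrier (Hgrp \<H> n (subpair Z' (middle N', ends N' B'))))
      (Hdelta \<H> (n - 1) (subpair Z' (middle N', ends N' B')))
      (Hmap \<H> (n - 1) (subpair Z (ends N B, {})) (subpair Z' (ends N' B', {})) \<Phi>)
      (Hmap \<H> n (subpair Z (middle N, ends N B)) (subpair Z' (middle N', ends N' B')) \<Phi>)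
      (Hdelta \<H> (n - 1) (subpair Z (middle N, ends N B)))"
    using Hdelta_commuting_square[of "subtopology Z (middle N)" "ends N B" "subtopology Z' (middle N')"
        "ends N' B'" \<Phi> "n - 1"] X(3) Y(3) \<Phi>p(3)
    by (simp add: subpair_def)
  show ?thesis
    unfolding mv_differential_eq[OF N_def B_def Z_def refl refl]
      mv_differential_eq[OF N'_def B'_def Z'_def refl refl]
    by (rule commuting_square_comp[OF commuting_square_comp[OF commuting_square_comp[OF commuting_square_comp[OF
        commuting_square_comp[OF commuting_square_comp[OF
          Hmap_commuting_square[OF X(6,8) Y(6,8) X(10) Y(10) \<phi>p(2) \<Phi>p(6) b]
          Hmap_inverse_commuting_square[OF X(6,5) Y(6,5) X(14) Y(14) \<Phi>p(5,6) _ X'(3) Y'(3)]]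
          Hmap_commuting_square[OF X(4,5) Y(4,5) X(13) Y(13) \<Phi>p(5,4)]]
          delta]
          Hmap_inverse_commuting_square[OF X(3,2) Y(3,2) X(12) Y(12) \<Phi>p(2,3) _ X'(4) Y'(4)]]
          Hmap_commuting_square[OF X(1,2) Y(1,2) X(11) Y(11) \<Phi>p(2,1)]]
          Hmap_inverse_commuting_square[OF X(1,7) Y(1,7) X(9) Y(9) \<phi>p(1) \<Phi>p(1) b X'(5) Y'(5)]])
      simp_all
qed

end

section \<open>The strip and its automorphisms\<close>

lemma g_tilde_add_2pi: "g_tilde a (\<theta> + 2 * pi * of_int k) = g_tilde a \<theta> + 2 * pi * of_int k"
proof -
  have "(\<theta> + 2 * pi * of_int k + pi / 2) / (2 * pi) = (\<theta> + pi / 2) / (2 * pi) + of_int k"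
    by (simp add: field_simps)
  then have f: "\<lfloor>(\<theta> + 2 * pi * of_int k + pi / 2) / (2 * pi)\<rfloor> = \<lfloor>(\<theta> + pi / 2) / (2 * pi)\<rfloor> + k"
    by simp
  show ?thesis
    unfolding g_tilde_def Let_def f by (simp add: algebra_simps)
qed

lemma g_tilde_plus_2pi: "g_tilde a (\<theta> + 2 * pi) = g_tilde a \<theta> + 2 * pi"
  using g_tilde_add_2pi[of a \<theta> 1] by simp

lemma g_tilde_minus_2pi: "g_tilde a (\<theta> - 2 * pi) = g_tilde a \<theta> - 2 * pi"
  using g_tilde_add_2pi[of a \<theta> "-1"] by simp

lemma floor_period:
  assumes "- pi / 2 \<le> \<theta>" "\<theta> < 3 * pi / 2"
  shows "\<lfloor>(\<theta> + pi / 2) / (2 * pi)\<rfloor> = 0"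
  using assms by (simp add: floor_eq_iff field_simps)

lemma g_tilde_even_cell:
  assumes "- pi / 2 < \<theta>" "\<theta> < pi / 2"
  shows "g_tilde a \<theta> = arctan (tan \<theta> + snd a)"
proof -
  have "\<lfloor>(\<theta> + pi / 2) / (2 * pi)\<rfloor> = 0"
    using assms pi_gt_zero by (intro floor_period) linarith+
  then show ?thesis using assms by (simp add: g_tilde_def)
qed

lemma g_tilde_odd_cell:
  assumes "pi / 2 < \<theta>" "\<theta> < 3 * pi / 2"
  shows "g_tilde a \<theta> = pi + arctan (tan \<theta> - fst a)"
proof -
  have "\<lfloor>(\<theta> + pi / 2) / (2 * pi)\<rfloor> = 0"
    using assms pi_gt_zero by (intro floor_period) linarith+
  then show ?thesis using assms by (simp add: g_tilde_def)
qed

lemma g_tilde_half_pi: "g_tilde a (pi / 2) = pi / 2" "g_tilde a (- pi / 2) = - pi / 2"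
  using floor_period[of "pi / 2"] floor_period[of "- pi / 2"] by (simp_all add: g_tilde_def)

lemma g_tilde_three_half_pi: "g_tilde a (3 * pi / 2) = 3 * pi / 2"
  using g_tilde_plus_2pi[of a "- pi / 2"] g_tilde_half_pi(2)[of a] by simp

lemma tan_minus_pi: "tan (\<theta> - pi) = tan \<theta>" for \<theta> :: real
  using tan_periodic_pi[of "\<theta> - pi"] by simp

lemma angle_period:
  fixes \<theta> :: real
  obtains k :: int and \<eta> where "\<theta> = \<eta> + 2 * pi * of_int k" "- pi / 2 \<le> \<eta>" "\<eta> < 3 * pi / 2"
proof -
  define k where "k = \<lfloor>(\<theta> + pi / 2) / (2 * pi)\<rfloor>"
  have "of_int k \<le> (\<theta> + pi / 2) / (2 * pi)" "(\<theta> + pi / 2) / (2 * pi) < of_int k + 1"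
    unfolding k_def by linarith+
  then have "- pi / 2 \<le> \<theta> - 2 * pi * of_int k" "\<theta> - 2 * pi * of_int k < 3 * pi / 2"
    by (auto simp: field_simps)
  then show ?thesis by (intro that[of "\<theta> - 2 * pi * of_int k" k]) auto
qed

lemma angle_cases:
  fixes \<theta> :: real
  obtains (fixed) k :: int where "\<theta> = - pi / 2 + 2 * pi * of_int k"
    | (fixed') k :: int where "\<theta> = pi / 2 + 2 * pi * of_int k"
    | (even_cell) k :: int and \<eta> where "\<theta> = \<eta> + 2 * pi * of_int k" "- pi / 2 < \<eta>" "\<eta> < pi / 2"
    | (odd_cell) k :: int and \<eta> where "\<theta> = \<eta> + 2 * pi * of_int k" "pi / 2 < \<eta>" "\<eta> < 3 * pi / 2"
proof -
  obtain k :: int and \<eta> where \<eta>: "\<theta> = \<eta> + 2 * pi * of_int k" "- pi / 2 \<le> \<eta>" "\<eta> < 3 * pi / 2"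
    by (rule angle_period)
  consider "\<eta> = - pi / 2" | "\<eta> = pi / 2" | "- pi / 2 < \<eta>" "\<eta> < pi / 2" | "pi / 2 < \<eta>" "\<eta> < 3 * pi / 2"
    using \<eta> by linarith
  then show ?thesis using \<eta> fixed fixed' even_cell odd_cell by cases metis+
qed

text \<open>In each cell \<open>g_tilde\<close> translates the tangent, by \<open>snd a\<close> or by \<open>- fst a\<close>, and \<open>- a\<close>
  translates it back.\<close>
lemma g_tilde_inverse: "g_tilde (- a) (g_tilde a \<theta>) = \<theta>"
proof (cases \<theta> rule: angle_cases)
  case (even_cell k \<eta>)
  have b: "- pi / 2 < arctan z \<and> arctan z < pi / 2" for z using arctan_bounded[of z] by simp
  show ?thesis
    using even_cell b by (simp add: g_tilde_add_2pi g_tilde_even_cell tan_arctan arctan_tan)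
next
  case (odd_cell k \<eta>)
  have "g_tilde (- a) (pi + arctan z) = pi + arctan (z + fst a)" for z
    using arctan_bounded[of z] tan_periodic_pi[of "arctan z"]
    by (subst g_tilde_odd_cell) (auto simp: add.commute tan_arctan)
  moreover have "arctan (tan \<eta>) = \<eta> - pi"
    using odd_cell arctan_tan[of "\<eta> - pi"] by (simp add: tan_minus_pi)
  ultimately show ?thesis using odd_cell by (simp add: g_tilde_add_2pi g_tilde_odd_cell)
next
  case (fixed k)
  have "g_tilde b \<theta> = \<theta>" for b using g_tilde_add_2pi[of b "- pi / 2" k] fixed by (simp add: g_tilde_half_pi[simplified])
  then show ?thesis by simp
next
  case (fixed' k)
  have "g_tilde b \<theta> = \<theta>" for b using g_tilde_add_2pi[of b "pi / 2" k] fixed' by (simp add: g_tilde_half_pi[simplified])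
  then show ?thesis by simp
qed

lemma g_tilde_mono_parameter:
  assumes "b \<preceq> c"
  shows "g_tilde b \<theta> \<le> g_tilde c \<theta>"
  using assms by (auto simp: g_tilde_def Let_def preceq_def arctan_monotone')

text \<open>The map preserves the two cells and the fixed angles of a period and increases in each cell.\<close>
lemma g_tilde_strict_mono:
  assumes "\<theta> < \<zeta>"
  shows "g_tilde a \<theta> < g_tilde a \<zeta>"
proof -
  have cell: "(- pi / 2 < \<eta> \<longrightarrow> - pi / 2 < g_tilde a \<eta>) \<and> - pi / 2 \<le> g_tilde a \<eta> \<and> g_tilde a \<eta> < 3 * pi / 2 \<and>
      (\<eta> < pi / 2 \<longrightarrow> g_tilde a \<eta> < pi / 2) \<and> (\<eta> \<le> pi / 2 \<longrightarrow> g_tilde a \<eta> \<le> pi / 2) \<and>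
      (pi / 2 < \<eta> \<longrightarrow> pi / 2 < g_tilde a \<eta>) \<and> (pi / 2 \<le> \<eta> \<longrightarrow> pi / 2 \<le> g_tilde a \<eta>)"
    if c: "- pi / 2 \<le> \<eta>" "\<eta> < 3 * pi / 2" for \<eta>
  proof -
    note b = arctan_bounded[of "tan \<eta> + snd a"] arctan_bounded[of "tan \<eta> - fst a"] pi_gt_zero
    consider "\<eta> = - pi / 2" | "\<eta> = pi / 2" | "- pi / 2 < \<eta>" "\<eta> < pi / 2" | "pi / 2 < \<eta>"
      using c by linarith
    then show ?thesis
    proof cases
      case 1
      have "g_tilde a \<eta> = - pi / 2" by (simp only: 1 g_tilde_half_pi)
      then show ?thesis using 1 b by (intro conjI impI; linarith)
    next
      case 2
      have "g_tilde a \<eta> = pi / 2" by (simp only: 2 g_tilde_half_pi)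
      then show ?thesis using 2 b by (intro conjI impI; linarith)
    next
      case 3
      then show ?thesis using g_tilde_even_cell[OF 3, of a] b by (intro conjI impI; linarith)
    next
      case 4
      then show ?thesis using g_tilde_odd_cell[OF 4 c(2), of a] b by (intro conjI impI; linarith)
    qed
  qed
  have base: "g_tilde a \<eta> < g_tilde a \<kappa>" if c: "- pi / 2 \<le> \<eta>" "\<eta> < \<kappa>" "\<kappa> < 3 * pi / 2" for \<eta> \<kappa>
  proof -
    have b: "\<eta> < 3 * pi / 2" "- pi / 2 \<le> \<kappa>" using c by linarith+
    consider "\<eta> = - pi / 2" | "- pi / 2 < \<eta>" "\<kappa> < pi / 2" | "pi / 2 < \<eta>"
      | "\<eta> \<le> pi / 2" "pi / 2 \<le> \<kappa>"
      using c by linarith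
    then show ?thesis
    proof cases
      case 1
      then have "g_tilde a \<eta> = - pi / 2" using g_tilde_half_pi by simp
      then show ?thesis using cell[OF b(2) c(3)] 1 c by linarith
    next
      case 2
      then have "tan \<eta> < tan \<kappa>" using c by (intro tan_monotone) auto
      then show ?thesis using 2 c by (simp add: g_tilde_even_cell arctan_less_iff)
    next
      case 3
      have "tan (\<eta> - pi) < tan (\<kappa> - pi)" using 3 c by (intro tan_monotone) auto
      then show ?thesis using 3 c by (simp add: g_tilde_odd_cell arctan_less_iff tan_minus_pi)
    next
      case 4
      then show ?thesis using cell[OF b(2) c(3)] cell[OF c(1) b(1)] c by linarith
    qed
  qed
  obtain k :: int and \<eta> where \<theta>: "\<theta> = \<eta> + 2 * pi * of_int k" "- pi / 2 \<le> \<eta>" "\<eta> < 3 * pi / 2"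
    by (rule angle_period)
  obtain l :: int and \<kappa> where \<zeta>: "\<zeta> = \<kappa> + 2 * pi * of_int l" "- pi / 2 \<le> \<kappa>" "\<kappa> < 3 * pi / 2"
    by (rule angle_period)
  have "k \<le> l"
  proof (rule ccontr)
    assume "\<not> k \<le> l"
    then have "2 * pi * of_int (l + 1) \<le> 2 * pi * of_int k" by (intro mult_left_mono) auto
    then show False using assms \<theta> \<zeta> by (simp add: algebra_simps)
  qed
  then consider "k = l" | "k + 1 \<le> l" by linarith
  then show ?thesis
  proof cases
    case 1
    then show ?thesis using base[of \<eta> \<kappa>] assms \<theta> \<zeta> by (simp add: g_tilde_add_2pi)
  next
    case 2
    then have "2 * pi * of_int (k + 1) \<le> 2 * pi * of_int l" by (intro mult_left_mono) auto
    moreover have "g_tilde a \<theta> = g_tilde a \<eta> + 2 * pi * of_int k" "g_tilde a \<zeta> = g_tilde a \<kappa> + 2 * pi * of_int l"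
      by (simp_all only: \<theta>(1) \<zeta>(1) g_tilde_add_2pi)
    ultimately show ?thesis
      using cell[OF \<theta>(2,3)] cell[OF \<zeta>(2,3)] by (simp add: algebra_simps)
  qed
qed

lemma g_tilde_mono: "\<theta> \<le> \<zeta> \<Longrightarrow> g_tilde a \<theta> \<le> g_tilde a \<zeta>"
  using g_tilde_strict_mono[of \<theta> \<zeta> a] by fastforce

text \<open>An upper bound \<open>\<theta>\<close> of \<open>arctan t\<close> that is not vacuous lies in an even cell, where \<open>g_tilde\<close>
  translates the tangent by \<open>snd a\<close>.  A lower bound is given by its reflection \<open>\<theta>\<close>, which then lies
  in an odd cell, where the tangent is translated by \<open>- fst a\<close>.\<close>

lemma arctan_less_g_tilde:
  assumes "arctan t < \<theta>" "s \<le> snd a"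
  shows "arctan (t + s) < g_tilde a \<theta>"
proof (cases "\<theta> < pi / 2")
  case True
  have "- pi / 2 < \<theta>" using assms arctan_bounded[of t] by linarith
  moreover have "t < tan \<theta>"
    using tan_monotone[of "arctan t" \<theta>] assms True arctan_bounded[of t] by (simp add: tan_arctan)
  ultimately show ?thesis using True assms by (simp add: g_tilde_even_cell arctan_less_iff)
next
  case False
  then show ?thesis
    using g_tilde_mono[of "pi / 2" \<theta> a] arctan_bounded[of "t + s"] by (simp add: g_tilde_half_pi)
qed

lemma less_arctan_g_tilde:
  assumes "- pi - \<theta> < arctan t" "fst a \<le> s"
  shows "- pi - g_tilde a \<theta> < arctan (t + s)"
proof (cases "\<theta> < - pi / 2")
  case True
  have \<theta>: "- 3 * pi / 2 < \<theta>" using assms arctan_bounded[of t] by linarith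
  then have "g_tilde a (\<theta> + 2 * pi) = pi + arctan (tan (\<theta> + 2 * pi) - fst a)"
    using True by (intro g_tilde_odd_cell) linarith+
  then have "- pi - g_tilde a \<theta> = arctan (fst a - tan \<theta>)"
    using g_tilde_plus_2pi[of a \<theta>] arctan_minus[of "tan \<theta> - fst a"] by (simp add: tan_periodic)
  moreover have "- pi - \<theta> = - \<theta> - pi" by simp
  then have "- tan \<theta> = tan (- pi - \<theta>)" by (simp only: tan_minus_pi tan_minus)
  then have "- tan \<theta> < t"
    using tan_monotone[of "- pi - \<theta>" "arctan t"] assms True arctan_bounded[of t] \<theta>
    by (simp add: tan_arctan)
  ultimately show ?thesis using assms by (simp add: arctan_less_iff)
next
  case False
  then show ?thesis
    using g_tilde_mono[of "- pi / 2" \<theta> a] arctan_bounded[of "t + s"] by (simp add: g_tilde_half_pi[simplified])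
qed

text \<open>This is the purpose of \<open>\<alpha>\<close>: if \<open>g - f\<close> lies between \<open>fst a\<close> and \<open>snd a\<close>, the preimages of
  \<open>\<rho> p\<close> under \<open>f\<close> are contained in those of \<open>\<rho> (\<alpha>_a p)\<close> under \<open>g\<close>.\<close>
lemma rho_alpha:
  assumes "fst a \<le> s" "s \<le> snd a"
  shows "t \<in> \<rho>1 p \<Longrightarrow> t + s \<in> \<rho>1 (alpha a p)" "t \<in> \<rho>0 p \<Longrightarrow> t + s \<in> \<rho>0 (alpha a p)"
proof -
  have "fst p < arctan t \<Longrightarrow> pi - g_tilde a (pi - fst p) < arctan (t + s)"
    using less_arctan_g_tilde[of "pi - fst p - 2 * pi" t a s] assms unfolding g_tilde_minus_2pi by simp
  then show "t \<in> \<rho>1 p \<Longrightarrow> t + s \<in> \<rho>1 (alpha a p)" "t \<in> \<rho>0 p \<Longrightarrow> t + s \<in> \<rho>0 (alpha a p)"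
    using arctan_less_g_tilde[of t "snd p" s a] arctan_less_g_tilde[of t "pi - fst p" s a]
      less_arctan_g_tilde[of "snd p" t a s] assms
    by (auto simp: \<rho>1_def \<rho>0_def alpha_def)
qed

lemma rho_mono:
  assumes "p \<preceq> q"
  shows "\<rho>1 p \<subseteq> \<rho>1 q" "\<rho>0 p \<subseteq> \<rho>0 q"
  using assms by (auto simp: \<rho>1_def \<rho>0_def preceq_def)

lemma rho0_subset_rho1:
  assumes "p \<in> strip"
  shows "\<rho>0 p \<subseteq> \<rho>1 p"
proof
  fix t assume "t \<in> \<rho>0 p"
  then show "t \<in> \<rho>1 p"
    using assms arctan_bounded[of t] by (auto simp: \<rho>1_def \<rho>0_def strip_def)
qed

lemma alpha_inverse: "alpha (- a) (alpha a u) = u"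
  by (simp add: alpha_def g_tilde_inverse)

text \<open>This turns the membership test for \<open>E = \<alpha>_(-a) (D)\<close> into one for \<open>D\<close>.\<close>
lemma mem_alpha_image: "p \<in> alpha (- a) ` S \<longleftrightarrow> alpha a p \<in> S"
  using alpha_inverse[of a] alpha_inverse[of "- a"] by (metis image_iff minus_minus)

lemma alpha_mono_parameter: "b \<preceq> c \<Longrightarrow> alpha b p \<preceq> alpha c p"
  using g_tilde_mono_parameter[of b c] by (simp add: alpha_def preceq_def)

lemma alpha_strip: "u \<in> strip \<Longrightarrow> alpha a u \<in> strip"
  using g_tilde_mono[of "snd u" "pi - fst u" a] g_tilde_mono[of "pi - fst u - 2 * pi" "snd u" a]
  unfolding g_tilde_minus_2pi by (auto simp: strip_def alpha_def)

lemma alpha_strip_T: "alpha a (strip_T u) = strip_T (alpha a u)"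
  using g_tilde_plus_2pi[of a "snd u"] by (simp add: alpha_def strip_T_def add.commute)

lemma strip_T_inverse [simp]: "strip_T (T_inv u) = u" "T_inv (strip_T u) = u"
  by (simp_all add: strip_T_def T_inv_def)

lemma T_pow_0 [simp]: "T_pow 0 u = u"
  by (simp add: T_pow_def)

lemma T_pow_add_1: "T_pow (n + 1) u = strip_T (T_pow n u)"
proof (cases "n \<ge> 0")
  case True
  then show ?thesis by (simp add: T_pow_def nat_add_distrib)
next
  case False
  then have "nat (- n) = Suc (nat (- (n + 1)))" by simp
  then show ?thesis using False by (simp add: T_pow_def)
qed

lemma T_pow_diff_1: "T_pow (n - 1) u = T_inv (T_pow n u)"
  using T_pow_add_1[of "n - 1" u] by simp

lemma alpha_T_inv: "alpha a (T_inv u) = T_inv (alpha a u)"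
  by (metis alpha_strip_T strip_T_inverse)

lemma alpha_T_pow: "alpha a (T_pow n u) = T_pow n (alpha a u)"
  by (induction n rule: int_induct[where k = 0])
    (simp_all add: T_pow_add_1 T_pow_diff_1 alpha_strip_T alpha_T_inv)

lemma T_pow_strip_T: "T_pow n (strip_T u) = strip_T (T_pow n u)"
  by (induction n rule: int_induct[where k = 0]) (simp_all add: T_pow_add_1 T_pow_diff_1)

lemma T_pow_mono_iff: "T_pow n u \<preceq> T_pow n v \<longleftrightarrow> u \<preceq> v"
  by (induction n rule: int_induct[where k = 0])
    (auto simp add: T_pow_add_1 T_pow_diff_1 preceq_def strip_T_def T_inv_def)

lemma T_pow_strip: "T_pow n u \<in> strip \<longleftrightarrow> u \<in> strip"
  by (induction n rule: int_induct[where k = 0])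
    (auto simp add: T_pow_add_1 T_pow_diff_1 strip_def strip_T_def T_inv_def case_prod_unfold)

lemma T_pow_diff: "fst (T_pow n u) - snd (T_pow n u) = fst u - snd u - 2 * pi * of_int n"
  by (induction n rule: int_induct[where k = 0])
    (simp_all add: T_pow_add_1 T_pow_diff_1 strip_T_def T_inv_def algebra_simps)

lemma fund_dom_iff: "p \<in> fund_dom \<longleftrightarrow> p \<in> strip \<and> 0 \<le> fst p - snd p \<and> fst p - snd p < 2 * pi"
  by (auto simp: fund_dom_def)

lemma level_eqI:
  assumes "T_pow n u \<in> fund_dom"
  shows "level u = n"
  unfolding level_def
proof (rule the_equality)
  show "T_pow n u \<in> fund_dom" by fact
  fix m assume m: "T_pow m u \<in> fund_dom"
  have "of_int n \<le> (fst u - snd u) / (2 * pi) \<and> (fst u - snd u) / (2 * pi) < of_int n + 1"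
    "of_int m \<le> (fst u - snd u) / (2 * pi) \<and> (fst u - snd u) / (2 * pi) < of_int m + 1"
    using assms m by (auto simp: fund_dom_iff T_pow_diff field_simps)
  then show "m = n" by linarith
qed

lemma T_pow_level:
  assumes "u \<in> strip"
  shows "T_pow (level u) u \<in> fund_dom"
proof -
  define n where "n = \<lfloor>(fst u - snd u) / (2 * pi)\<rfloor>"
  have "of_int n \<le> (fst u - snd u) / (2 * pi) \<and> (fst u - snd u) / (2 * pi) < of_int n + 1"
    unfolding n_def by linarith
  then have "T_pow n u \<in> fund_dom"
    using assms by (auto simp: fund_dom_iff T_pow_diff T_pow_strip field_simps)
  then show ?thesis using level_eqI by metis
qed

text \<open>On the open square with corners \<open>(\<plusminus> pi / 2, \<plusminus> pi / 2)\<close> the automorphism translates the tangents.\<close>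

lemma alpha_arctan: "alpha a (arctan s, arctan r) = (arctan (s + fst a), arctan (r + snd a))"
proof -
  have "g_tilde a (pi - arctan s) = pi + arctan (tan (pi - arctan s) - fst a)"
    using arctan_bounded[of s] by (intro g_tilde_odd_cell) auto
  also have "tan (pi - arctan s) = - s"
    using tan_minus_pi[of "- arctan s"] tan_minus_pi[of "arctan s"] by (metis minus_diff_eq tan_minus tan_arctan)
  finally have "g_tilde a (pi - arctan s) = pi - arctan (s + fst a)"
    using arctan_minus[of "s + fst a"] by (simp add: algebra_simps)
  moreover have "g_tilde a (arctan r) = arctan (r + snd a)"
    using arctan_bounded[of r] by (simp add: g_tilde_even_cell tan_arctan)
  ultimately show ?thesis by (simp add: alpha_def)
qed

lemma alpha_lower_left:
  "alpha a (arctan s, - pi - arctan s) = (arctan (s + fst a), - pi - arctan (s + fst a))"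
proof -
  have "g_tilde a (- pi - arctan s) = g_tilde a (pi - arctan s) - 2 * pi"
    using g_tilde_minus_2pi[of a "pi - arctan s"] by simp
  then show ?thesis using alpha_arctan[of a s 0] by (simp add: alpha_def)
qed

lemma alpha_upper_right:
  "alpha a (pi - arctan r, arctan r) = (pi - arctan (r + snd a), arctan (r + snd a))"
  using alpha_arctan[of a 0 r] by (simp add: alpha_def)

lemma in_open_square:
  assumes "- pi / 2 < x" "x < pi / 2" "- pi / 2 < y" "y < pi / 2"
  obtains s r where "(x, y) = (arctan s, arctan r)"
  using assms arctan_tan[of x] arctan_tan[of y] by (metis minus_divide_left)

text \<open>The lines on which one coordinate is \<open>\<plusminus> pi / 2\<close> are invariant, because \<open>g_tilde\<close> fixes the odd
  multiples of \<open>pi / 2\<close>.\<close>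

lemma alpha_bounds:
  "fst u \<le> - pi / 2 \<Longrightarrow> fst (alpha a u) \<le> - pi / 2" "- pi / 2 \<le> fst u \<Longrightarrow> - pi / 2 \<le> fst (alpha a u)"
  "fst u < pi / 2 \<Longrightarrow> fst (alpha a u) < pi / 2" "pi / 2 \<le> fst u \<Longrightarrow> pi / 2 \<le> fst (alpha a u)"
  "snd u \<le> - pi / 2 \<Longrightarrow> snd (alpha a u) \<le> - pi / 2" "- pi / 2 < snd u \<Longrightarrow> - pi / 2 < snd (alpha a u)"
  "snd u \<le> pi / 2 \<Longrightarrow> snd (alpha a u) \<le> pi / 2" "pi / 2 \<le> snd u \<Longrightarrow> pi / 2 \<le> snd (alpha a u)"
  unfolding alpha_def fst_conv snd_conv
  subgoal using g_tilde_mono[of "3 * pi / 2" "pi - fst u" a] unfolding g_tilde_three_half_pi by linarith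
  subgoal using g_tilde_mono[of "pi - fst u" "3 * pi / 2" a] unfolding g_tilde_three_half_pi by linarith
  subgoal using g_tilde_strict_mono[of "pi / 2" "pi - fst u" a] unfolding g_tilde_half_pi by linarith
  subgoal using g_tilde_mono[of "pi - fst u" "pi / 2" a] unfolding g_tilde_half_pi by linarith
  subgoal using g_tilde_mono[of "snd u" "- pi / 2" a] unfolding g_tilde_half_pi by linarith
  subgoal using g_tilde_strict_mono[of "- pi / 2" "snd u" a] unfolding g_tilde_half_pi by linarith
  subgoal using g_tilde_mono[of "snd u" "pi / 2" a] unfolding g_tilde_half_pi by linarith
  subgoal using g_tilde_mono[of "pi / 2" "snd u" a] unfolding g_tilde_half_pi by linarith
  done

lemma alpha_above_diagonal:
  assumes "u \<in> strip" "fst u < snd u" "fst a \<le> snd a"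
  shows "fst (alpha a u) < snd (alpha a u)"
proof -
  have s: "- pi \<le> fst u + snd u" "fst u + snd u \<le> pi" using assms(1) by (auto simp: strip_def)
  consider "fst u \<le> - pi / 2" "- pi / 2 < snd u" | "pi / 2 \<le> snd u" "fst u < pi / 2"
    | "- pi / 2 < fst u" "snd u < pi / 2"
    using s assms(2) by linarith
  then show ?thesis
  proof cases
    case 3
    then obtain s r where "u = (arctan s, arctan r)"
      using in_open_square[of "fst u" "snd u"] assms(2) by (metis order.strict_trans prod.collapse)
    then show ?thesis using assms by (simp add: alpha_arctan arctan_less_iff)
  qed (use alpha_bounds[where u = u and a = a] in linarith)+
qed

text \<open>If a point on or below the diagonal is outside the open square, one of the angles \<open>\<plusminus> pi / 2\<close>
  separates its coordinates, and by \<open>alpha_bounds\<close> it still does so after the shift.\<close>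
lemma alpha_crosses_diagonal:
  assumes "p \<in> strip" "snd p \<le> fst p" "fst (alpha a p) < snd (alpha a p)"
  obtains s r where "p = (arctan s, arctan r)" "r \<le> s" "s + fst a < r + snd a"
proof -
  have s: "- pi \<le> fst p + snd p" "fst p + snd p \<le> pi" using assms(1) by (auto simp: strip_def)
  note b = alpha_bounds[where u = p and a = a]
  have "- pi / 2 < snd p"
  proof (rule ccontr)
    assume "\<not> - pi / 2 < snd p"
    then have "snd p \<le> - pi / 2" "- pi / 2 \<le> fst p" using s by linarith+
    then show False using b assms(3) by linarith
  qed
  moreover have "fst p < pi / 2"
  proof (rule ccontr)
    assume "\<not> fst p < pi / 2"
    then have "pi / 2 \<le> fst p" "snd p \<le> pi / 2" using s by linarith+
    then show False using b assms(3) by linarith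
  qed
  ultimately obtain s r where p: "p = (arctan s, arctan r)"
    using in_open_square[of "fst p" "snd p"] assms(2)
    by (metis order.strict_trans2 order.strict_trans1 prod.collapse)
  then show ?thesis using assms that by (simp add: alpha_arctan arctan_less_iff arctan_le_iff)
qed

text \<open>Applying \<open>T\<close> turns the upper boundary line of \<open>D\<close> into the diagonal, where
  \<open>alpha_above_diagonal\<close> applies.\<close>
lemma alpha_below_next_domain:
  assumes "p \<in> fund_dom" "fst a \<le> snd a"
  shows "fst (alpha a p) - snd (alpha a p) < 2 * pi"
proof -
  have "strip_T p \<in> strip" "fst (strip_T p) < snd (strip_T p)"
    using assms by (auto simp: fund_dom_iff strip_def strip_T_def)
  then have "fst (strip_T (alpha a p)) < snd (strip_T (alpha a p))"
    using alpha_above_diagonal assms(2) by (metis alpha_strip_T)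
  then show ?thesis by (simp add: strip_T_def)
qed

lemma level_alpha_same:
  assumes "u \<in> strip" "alpha a (T_pow (level u) u) \<in> fund_dom"
  shows "level (alpha a u) = level u" "T_pow (level u) (alpha a u) = alpha a (T_pow (level u) u)"
  using assms level_eqI by (auto simp: alpha_T_pow)

text \<open>A shift can move a point out of \<open>D\<close> only across the diagonal, because
  \<open>alpha_below_next_domain\<close> keeps it below the other boundary line.\<close>
lemma alpha_leaves_domain:
  assumes "p \<in> fund_dom" "fst a \<le> snd a" "alpha a p \<notin> fund_dom"
  obtains s r where "p = (arctan s, arctan r)" "r \<le> s" "s + fst a < r + snd a"
proof -
  have p: "p \<in> strip" "snd p \<le> fst p" using assms(1) by (auto simp: fund_dom_iff)
  have "fst (alpha a p) < snd (alpha a p)"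
    using alpha_below_next_domain[OF assms(1,2)] assms(3) alpha_strip[OF p(1), of a] by (auto simp: fund_dom_iff)
  then show ?thesis using alpha_crosses_diagonal[OF p] that by blast
qed

lemma T_inv_in_fund_dom:
  assumes "r' > s'"
  shows "T_inv (arctan s', arctan r') \<in> fund_dom"
  using assms arctan_bounded[of s'] arctan_bounded[of r'] arctan_less_iff[of s' r']
  by (auto simp: fund_dom_iff T_inv_def strip_def)

lemma level_alpha_pred:
  assumes "T_pow (level u) u = (arctan s, arctan r)" "s + fst a < r + snd a"
  shows "level (alpha a u) = level u - 1"
    "T_pow (level u - 1) (alpha a u) = T_inv (arctan (s + fst a), arctan (r + snd a))"
proof -
  have "T_pow (level u) (alpha a u) = (arctan (s + fst a), arctan (r + snd a))"
    using assms alpha_arctan by (metis alpha_T_pow)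
  then show *: "T_pow (level u - 1) (alpha a u) = T_inv (arctan (s + fst a), arctan (r + snd a))"
    by (simp add: T_pow_diff_1)
  show "level (alpha a u) = level u - 1"
    by (rule level_eqI) (use assms T_inv_in_fund_dom in \<open>simp add: *\<close>)
qed

text \<open>The values of \<open>\<rho>\<close> at the points that occur in the rectangles: the upper left corner in the open
  square, its two neighbours on the boundary lines, and the lower right corner.\<close>
lemma rho_square: "\<rho>1 (arctan s, arctan r) = UNIV" "\<rho>0 (arctan s, arctan r) = {..<r} \<union> {s<..}"
proof -
  have "- pi - arctan r < arctan t \<and> arctan t < pi - arctan s" for t
    using arctan_bounded[of r] arctan_bounded[of s] arctan_bounded[of t] by linarith
  then show "\<rho>1 (arctan s, arctan r) = UNIV" by (simp add: \<rho>1_def)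
qed (auto simp: \<rho>0_def arctan_less_iff)

lemma rho_lower_left:
  "\<rho>1 (arctan s, - pi - arctan s') = {s'<..}" "\<rho>0 (arctan s, - pi - arctan s') = {s<..}"
proof -
  have *: "arctan t < pi - arctan s" "\<not> arctan t < - pi - arctan s'" for t
    using arctan_bounded[of s] arctan_bounded[of s'] arctan_bounded[of t] by linarith+
  then show "\<rho>1 (arctan s, - pi - arctan s') = {s'<..}" "\<rho>0 (arctan s, - pi - arctan s') = {s<..}"
    by (auto simp: \<rho>1_def \<rho>0_def arctan_less_iff)
qed

lemma rho_upper_right:
  "\<rho>1 (pi - arctan r', arctan r) = {..<r'}" "\<rho>0 (pi - arctan r', arctan r) = {..<r}"
proof -
  have *: "- pi - arctan r < arctan t" "\<not> pi - arctan r' < arctan t" for t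
    using arctan_bounded[of r] arctan_bounded[of r'] arctan_bounded[of t] by linarith+
  then show "\<rho>1 (pi - arctan r', arctan r) = {..<r'}" "\<rho>0 (pi - arctan r', arctan r) = {..<r}"
    by (auto simp: \<rho>1_def \<rho>0_def arctan_less_iff)
qed

lemma rho_T_inv: "\<rho>1 (T_inv (arctan s, arctan r)) = {s<..<r}" "\<rho>0 (T_inv (arctan s, arctan r)) = {}"
proof -
  have *: "\<not> arctan t < - pi - arctan s" "\<not> pi - arctan r < arctan t" for t
    using arctan_bounded[of s] arctan_bounded[of r] arctan_bounded[of t] by linarith+
  then show "\<rho>1 (T_inv (arctan s, arctan r)) = {s<..<r}" "\<rho>0 (T_inv (arctan s, arctan r)) = {}"
    by (auto simp: \<rho>1_def \<rho>0_def T_inv_def arctan_less_iff)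
qed

section \<open>Distances and level sets\<close>

lemma dist_vec_bounds:
  assumes "S \<noteq> {}" and b: "\<And>x. x \<in> S \<Longrightarrow> c1 \<le> g x - f x \<and> g x - f x \<le> c2"
  shows "c1 \<le> fst (dist_vec S f g)" "snd (dist_vec S f g) \<le> c2"
    and "\<And>x. x \<in> S \<Longrightarrow> fst (dist_vec S f g) \<le> g x - f x \<and> g x - f x \<le> snd (dist_vec S f g)"
proof -
  obtain x0 where x0: "x0 \<in> S" using assms by auto
  let ?l = "INF x\<in>S. ereal (g x - f x)" and ?u = "SUP x\<in>S. ereal (g x - f x)"
  have l: "ereal c1 \<le> ?l" using b by (intro INF_greatest) auto
  have u: "?u \<le> ereal c2" using b by (intro SUP_least) auto
  have lx: "?l \<le> ereal (g x - f x)" "ereal (g x - f x) \<le> ?u" if "x \<in> S" for x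
    using that by (auto intro: INF_lower SUP_upper)
  obtain l' where l': "?l = ereal l'" using l lx(1)[OF x0] by (cases ?l) auto
  obtain u' where u': "?u = ereal u'" using u lx(2)[OF x0] by (cases ?u) auto
  have d: "dist_vec S f g = (l', u')" by (simp add: dist_vec_def dist_ext_def l' u')
  show "c1 \<le> fst (dist_vec S f g)" "snd (dist_vec S f g) \<le> c2"
    and "\<And>x. x \<in> S \<Longrightarrow> fst (dist_vec S f g) \<le> g x - f x \<and> g x - f x \<le> snd (dist_vec S f g)"
    using l u lx unfolding d l' u' by auto
qed

lemma finite_dist_vec_bounds:
  assumes "finite_pair (dist_ext S f g)" "x \<in> S"
  shows "fst (dist_vec S f g) \<le> g x - f x \<and> g x - f x \<le> snd (dist_vec S f g)"
proof -
  let ?l = "INF x\<in>S. ereal (g x - f x)" and ?u = "SUP x\<in>S. ereal (g x - f x)"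
  have "?l \<le> ereal (g x - f x)" "ereal (g x - f x) \<le> ?u"
    using assms(2) by (auto intro: INF_lower SUP_upper)
  moreover obtain l' u' where "?l = ereal l'" "?u = ereal u'"
    using assms(1) unfolding finite_pair_def dist_ext_def fst_conv snd_conv
    by (metis abs_neq_infinity_cases)
  ultimately show ?thesis by (simp add: dist_vec_def dist_ext_def)
qed

lemma openin_preim: "continuous_map X euclideanreal f \<Longrightarrow> open U \<Longrightarrow> openin X (preim X f U)"
  using openin_continuous_map_preimage[of X euclideanreal f U] by (simp add: preim_def)

lemma is_pair_interlevel: "p \<in> strip \<Longrightarrow> is_pair (subpair X (interlevel X f p))"
  using rho0_subset_rho1[of p] by (auto simp: is_pair_def subpair_def interlevel_def preim_def)

lemma pair_map_interlevel:
  assumes "continuous_map X Y \<phi>"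
    and "\<And>x. x \<in> topspace X \<Longrightarrow> f x \<in> \<rho>1 p \<Longrightarrow> g (\<phi> x) \<in> \<rho>1 q"
    and "\<And>x. x \<in> topspace X \<Longrightarrow> f x \<in> \<rho>0 p \<Longrightarrow> g (\<phi> x) \<in> \<rho>0 q"
  shows "pair_map (subpair X (interlevel X f p)) (subpair Y (interlevel Y g q)) \<phi>"
  by (rule pair_map_subpair[OF assms(1)])
    (use assms(2,3) continuous_map_image_subset_topspace[OF assms(1)] in \<open>auto simp: interlevel_def preim_def\<close>)

lemma interlevel_square:
  "interlevel X f (arctan s, arctan r) = (topspace X, preim X f {s<..} \<union> preim X f {..<r})"
  by (auto simp: interlevel_def rho_square preim_def)

lemma interlevel_T_inv:
  "interlevel X f (T_inv (arctan s, arctan r)) = (preim X f {s<..} \<inter> preim X f {..<r}, {})"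
  by (auto simp: interlevel_def rho_T_inv preim_def)

text \<open>The pairs at the lower left and the upper right corner of the rectangles.\<close>

definition superlevel_pair :: "'u topology \<Rightarrow> ('u \<Rightarrow> real) \<Rightarrow> ('u \<Rightarrow> real) \<Rightarrow> real \<Rightarrow> real \<Rightarrow> 'u set \<times> 'u set" where
  "superlevel_pair X g f s' s = (preim X g {s'<..}, preim X f {s<..})"

definition sublevel_pair :: "'u topology \<Rightarrow> ('u \<Rightarrow> real) \<Rightarrow> ('u \<Rightarrow> real) \<Rightarrow> real \<Rightarrow> real \<Rightarrow> 'u set \<times> 'u set" where
  "sublevel_pair X g f r' r = (preim X g {..<r'}, preim X f {..<r})"

lemma open_pair_level:
  assumes "continuous_map X euclideanreal f" "continuous_map X euclideanreal g"
  shows "(\<And>x. x \<in> topspace X \<Longrightarrow> s < f x \<Longrightarrow> s' < g x) \<Longrightarrow> open_pair X (superlevel_pair X g f s' s)"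
    and "(\<And>x. x \<in> topspace X \<Longrightarrow> f x < r \<Longrightarrow> g x < r') \<Longrightarrow> open_pair X (sublevel_pair X g f r' r)"
  using openin_preim[OF assms(1) open_greaterThan, of s] openin_preim[OF assms(2) open_greaterThan, of s']
    openin_preim[OF assms(1) open_lessThan, of r] openin_preim[OF assms(2) open_lessThan, of r']
  by (auto simp: open_pair_def superlevel_pair_def sublevel_pair_def preim_def)

lemma levels_cover: "s < r \<Longrightarrow> preim X g {s<..} \<union> preim X g {..<r} = topspace X"
  by (auto simp: preim_def)

lemma levels_disjoint: "r \<le> s \<Longrightarrow> preim X f {s<..} \<inter> preim X f {..<r} = {}"
  by (auto simp: preim_def)

context cohomology_with_cylinders
begin

text \<open>\<open>mv_differential_natural\<close> for super- and sublevel sets.  The conditions on the levels make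
  the spaces of the two corners cover the whole space and their subspaces disjoint.\<close>
lemma mv_level_natural:
  assumes \<phi>: "continuous_map X Y \<phi>"
    and cont: "continuous_map X euclideanreal f" "continuous_map X euclideanreal g"
      "continuous_map Y euclideanreal f'" "continuous_map Y euclideanreal g'"
    and X: "\<And>x. x \<in> topspace X \<Longrightarrow> s < f x \<Longrightarrow> \<sigma> < g x" "\<And>x. x \<in> topspace X \<Longrightarrow> f x < r \<Longrightarrow> g x < \<tau>"
    and Y: "\<And>y. y \<in> topspace Y \<Longrightarrow> s' < f' y \<Longrightarrow> \<sigma>' < g' y" "\<And>y. y \<in> topspace Y \<Longrightarrow> f' y < r' \<Longrightarrow> g' y < \<tau>'"
    and f: "\<And>x. x \<in> topspace X \<Longrightarrow> s < f x \<Longrightarrow> s' < f' (\<phi> x)" "\<And>x. x \<in> topspace X \<Longrightarrow> f x < r \<Longrightarrow> f' (\<phi> x) < r'"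
    and g: "\<And>x. x \<in> topspace X \<Longrightarrow> \<sigma> < g x \<Longrightarrow> \<sigma>' < g' (\<phi> x)" "\<And>x. x \<in> topspace X \<Longrightarrow> g x < \<tau> \<Longrightarrow> g' (\<phi> x) < \<tau>'"
    and order: "r \<le> s" "r' \<le> s'" "\<sigma> < \<tau>" "\<sigma>' < \<tau>'"
  shows "commuting_square
    (carrier (Hgrp \<H> (n - 1) (subpair Y (preim Y g' {\<sigma>'<..} \<inter> preim Y g' {..<\<tau>'}, {}))))
    (carrier (Hgrp \<H> n (subpair Y (topspace Y, preim Y f' {s'<..} \<union> preim Y f' {..<r'}))))
    (mv_differential \<H> n Y (superlevel_pair Y g' f' \<sigma>' s') (sublevel_pair Y g' f' \<tau>' r'))
    (Hmap \<H> (n - 1) (subpair X (preim X g {\<sigma><..} \<inter> preim X g {..<\<tau>}, {}))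
      (subpair Y (preim Y g' {\<sigma>'<..} \<inter> preim Y g' {..<\<tau>'}, {})) \<phi>)
    (Hmap \<H> n (subpair X (topspace X, preim X f {s<..} \<union> preim X f {..<r}))
      (subpair Y (topspace Y, preim Y f' {s'<..} \<union> preim Y f' {..<r'})) \<phi>)
    (mv_differential \<H> n X (superlevel_pair X g f \<sigma> s) (sublevel_pair X g f \<tau> r))"
proof -
  have im: "\<phi> x \<in> topspace Y" if "x \<in> topspace X" for x
    using \<phi> that by (auto simp: continuous_map_def)
  have "commuting_square
    (carrier (Hgrp \<H> (n - 1) (subpair Y (fst (superlevel_pair Y g' f' \<sigma>' s') \<inter> fst (sublevel_pair Y g' f' \<tau>' r'),
      snd (superlevel_pair Y g' f' \<sigma>' s') \<inter> snd (sublevel_pair Y g' f' \<tau>' r')))))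
    (carrier (Hgrp \<H> n (subpair Y (fst (superlevel_pair Y g' f' \<sigma>' s') \<union> fst (sublevel_pair Y g' f' \<tau>' r'),
      snd (superlevel_pair Y g' f' \<sigma>' s') \<union> snd (sublevel_pair Y g' f' \<tau>' r')))))
    (mv_differential \<H> n Y (superlevel_pair Y g' f' \<sigma>' s') (sublevel_pair Y g' f' \<tau>' r'))
    (Hmap \<H> (n - 1) (subpair X (fst (superlevel_pair X g f \<sigma> s) \<inter> fst (sublevel_pair X g f \<tau> r),
      snd (superlevel_pair X g f \<sigma> s) \<inter> snd (sublevel_pair X g f \<tau> r)))
      (subpair Y (fst (superlevel_pair Y g' f' \<sigma>' s') \<inter> fst (sublevel_pair Y g' f' \<tau>' r'),
      snd (superlevel_pair Y g' f' \<sigma>' s') \<inter> snd (sublevel_pair Y g' f' \<tau>' r'))) \<phi>)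
    (Hmap \<H> n (subpair X (fst (superlevel_pair X g f \<sigma> s) \<union> fst (sublevel_pair X g f \<tau> r),
      snd (superlevel_pair X g f \<sigma> s) \<union> snd (sublevel_pair X g f \<tau> r)))
      (subpair Y (fst (superlevel_pair Y g' f' \<sigma>' s') \<union> fst (sublevel_pair Y g' f' \<tau>' r'),
      snd (superlevel_pair Y g' f' \<sigma>' s') \<union> snd (sublevel_pair Y g' f' \<tau>' r'))) \<phi>)
    (mv_differential \<H> n X (superlevel_pair X g f \<sigma> s) (sublevel_pair X g f \<tau> r))"
  proof (rule mv_differential_natural[OF \<phi>])
    show "open_pair X (superlevel_pair X g f \<sigma> s)" "open_pair X (sublevel_pair X g f \<tau> r)"
      using open_pair_level[OF cont(1,2)] X by blast+
    show "open_pair Y (superlevel_pair Y g' f' \<sigma>' s')" "open_pair Y (sublevel_pair Y g' f' \<tau>' r')"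
      using open_pair_level[OF cont(3,4)] Y by blast+
  qed (use f g im in \<open>auto simp: superlevel_pair_def sublevel_pair_def preim_def\<close>)
  then show ?thesis
    using order by (simp add: superlevel_pair_def sublevel_pair_def levels_cover levels_disjoint)
qed

section \<open>The composites at a point\<close>

text \<open>If even the larger shift \<open>c\<close> keeps \<open>p\<close> in the domain, so does \<open>a\<close>, and all three maps of the
  composite are induced by maps of pairs.\<close>
lemma composite_same_level:
  assumes cont: "continuous_map X Y \<phi>"
    and a: "a = dist_vec (topspace X) f (g \<circ> \<phi>)" "a \<preceq> c" "fst a \<le> snd a"
      "\<And>x. x \<in> topspace X \<Longrightarrow> fst a \<le> g (\<phi> x) - f x \<and> g (\<phi> x) - f x \<le> snd a"
    and u: "u \<in> strip" "n = level u" "p = T_pow n u" "alpha c p \<in> fund_dom"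
    and z: "z \<in> carrier (Hgrp \<H> n (subpair Y (interlevel Y g (alpha c p))))"
  shows "(h_vec \<H> X f (g \<circ> \<phi>) \<odot>\<odot> shift_le (h_fun \<H> X (g \<circ> \<phi>)) a c \<odot>\<odot> shift_nt (h_ind \<H> X Y g \<phi>) c) u z
    = Hmap \<H> n (subpair X (interlevel X f p)) (subpair Y (interlevel Y g (alpha c p))) \<phi> z"
proof -
  have p: "p \<in> fund_dom" "p \<in> strip" using T_pow_level[OF u(1)] u by (auto simp: T_pow_strip)
  have "alpha a p \<in> fund_dom"
  proof (rule ccontr)
    assume "alpha a p \<notin> fund_dom"
    then obtain s r where p': "p = (arctan s, arctan r)" "s + fst a < r + snd a"
      using alpha_leaves_domain[OF p(1) a(3)] by metis
    then have "s + fst c < r + snd c" using a(2) by (simp add: preceq_def)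
    then show False using u(4) by (simp add: p' alpha_arctan fund_dom_iff arctan_le_iff)
  qed
  then have pa: "alpha a p \<in> fund_dom" "alpha a (T_pow (level u) u) \<in> fund_dom"
    "alpha c (T_pow (level u) u) \<in> fund_dom" using u by auto
  note la = level_alpha_same[OF u(1) pa(2), folded u(2), folded u(3)]
  note lc = level_alpha_same[OF u(1) pa(3), folded u(2), folded u(3)]
  let ?P = "subpair X (interlevel X f p)" and ?A = "subpair X (interlevel X (g \<circ> \<phi>) (alpha a p))"
    and ?C = "subpair X (interlevel X (g \<circ> \<phi>) (alpha c p))" and ?Y = "subpair Y (interlevel Y g (alpha c p))"
  have eq: "(h_vec \<H> X f (g \<circ> \<phi>) \<odot>\<odot> shift_le (h_fun \<H> X (g \<circ> \<phi>)) a c \<odot>\<odot> shift_nt (h_ind \<H> X Y g \<phi>) c) u z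
    = Hmap \<H> n ?P ?A id (Hmap \<H> n ?A ?C id (Hmap \<H> n ?C ?Y \<phi> z))"
    unfolding nt_comp_def shift_le_def shift_nt_def h_vec_def h_fun_def h_ind_def Let_def a(1)[symmetric]
      u(2)[symmetric] u(3)[symmetric]
    by (simp add: la lc mem_alpha_image pa(1))
  have pairs: "is_pair ?P" "is_pair ?A" "is_pair ?C" "is_pair ?Y"
    by (intro is_pair_interlevel alpha_strip p)+
  have PA: "pair_map ?P ?A id"
  proof (rule pair_map_interlevel[OF continuous_map_id])
    fix x assume x: "x \<in> topspace X"
    note r = rho_alpha[of a "g (\<phi> x) - f x" "f x" p]
    show "f x \<in> \<rho>1 p \<Longrightarrow> (g \<circ> \<phi>) (id x) \<in> \<rho>1 (alpha a p)" "f x \<in> \<rho>0 p \<Longrightarrow> (g \<circ> \<phi>) (id x) \<in> \<rho>0 (alpha a p)"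
      using r a(4)[OF x] by auto
  qed
  have AC: "pair_map ?A ?C id"
    by (rule pair_map_interlevel[OF continuous_map_id])
      (use rho_mono[OF alpha_mono_parameter[OF a(2)], of p] in auto)
  have CY: "pair_map ?C ?Y \<phi>" by (rule pair_map_interlevel[OF cont]) auto
  have PC: "pair_map ?P ?C id"
    using PA AC unfolding pair_map_def by (auto intro: continuous_map_compose[of _ _ id _ id, simplified])
  have "Hmap \<H> n ?P ?A id (Hmap \<H> n ?A ?C id (Hmap \<H> n ?C ?Y \<phi> z)) = Hmap \<H> n ?P ?C id (Hmap \<H> n ?C ?Y \<phi> z)"
    using Hmap_comp[OF pairs(1,2,3) PA AC Hmap_closed[OF pairs(3,4) CY z]] by simp
  also have "\<dots> = Hmap \<H> n ?P ?Y \<phi> z"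
    using Hmap_comp[OF pairs(1,3,4) PC CY z] by simp
  finally show ?thesis unfolding eq .
qed

text \<open>The right-hand side depends on \<open>\<phi>\<close> and \<open>c\<close>, but not on \<open>a\<close>; this is what makes the composites
  for the two ends of a homotopy comparable.\<close>
lemma composite_lower_level:
  assumes cont: "continuous_map X Y \<phi>" "continuous_map X euclideanreal f" "continuous_map Y euclideanreal g"
    and a: "a = dist_vec (topspace X) f (g \<circ> \<phi>)" "a \<preceq> c" "fst a \<le> snd a"
      "\<And>x. x \<in> topspace X \<Longrightarrow> fst a \<le> g (\<phi> x) - f x \<and> g (\<phi> x) - f x \<le> snd a"
    and u: "u \<in> strip" "n = level u" "T_pow n u = (arctan s, arctan r)" "r \<le> s" "s + fst c < r + snd c"
    and z: "z \<in> carrier (Hgrp \<H> (n - 1) (subpair Y (preim Y g {s + fst c<..} \<inter> preim Y g {..<r + snd c}, {})))"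
  shows "(h_vec \<H> X f (g \<circ> \<phi>) \<odot>\<odot> shift_le (h_fun \<H> X (g \<circ> \<phi>)) a c \<odot>\<odot> shift_nt (h_ind \<H> X Y g \<phi>) c) u z
    = mv_differential \<H> n X (superlevel_pair X (g \<circ> \<phi>) f (s + fst c) s) (sublevel_pair X (g \<circ> \<phi>) f (r + snd c) r)
       (Hmap \<H> (n - 1) (subpair X (preim X (g \<circ> \<phi>) {s + fst c<..} \<inter> preim X (g \<circ> \<phi>) {..<r + snd c}, {}))
         (subpair Y (preim Y g {s + fst c<..} \<inter> preim Y g {..<r + snd c}, {})) \<phi> z)"
    (is "?lhs = mv_differential \<H> n X ?U ?L (Hmap \<H> (n - 1) ?C ?Y \<phi> z)")
proof -
  define p where "p = T_pow n u"
  have p: "p \<in> fund_dom" "p \<in> strip" using T_pow_level[OF u(1)] u(1,2) by (auto simp: p_def T_pow_strip)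
  have p_eq: "p = (arctan s, arctan r)" using u(3) by (simp add: p_def)
  have cont': "continuous_map X euclideanreal (g \<circ> \<phi>)" using continuous_map_compose[OF cont(1,3)] .
  note lc = level_alpha_pred[OF u(3)[unfolded u(2)] u(5), folded u(2)]
  have ac: "fst c \<le> fst a" "snd a \<le> snd c" using a(2) by (auto simp: preceq_def)
  have pC: "is_pair ?C" "is_pair ?Y" by (simp_all add: subpair_def)
  have CY: "pair_map ?C ?Y \<phi>"
    by (rule pair_map_subpair[OF cont(1)])
      (use continuous_map_image_subset_topspace[OF cont(1)] in \<open>auto simp: preim_def\<close>)
  define w where "w = Hmap \<H> (n - 1) ?C ?Y \<phi> z"
  have w: "w \<in> carrier (Hgrp \<H> (n - 1) ?C)" unfolding w_def by (rule Hmap_closed[OF pC CY z])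
  have hind: "h_ind \<H> X Y g \<phi> (alpha c u) z = w"
    by (simp add: h_ind_def Let_def lc interlevel_T_inv w_def)
  have pX: "is_pair (subpair X (topspace X, preim X f {s<..} \<union> preim X f {..<r}))"
    by (auto simp: is_pair_def subpair_def preim_def)
  have lhs: "?lhs = h_vec \<H> X f (g \<circ> \<phi>) u (mor (h_fun \<H> X (g \<circ> \<phi>)) (alpha a u) (alpha c u) w)"
    by (simp add: nt_comp_def shift_le_def shift_nt_def hind)
  \<comment> \<open>Which of the two maps is the differential depends on whether the point leaves the domain already
    under the shift by \<open>a\<close>; the other one is an inclusion.\<close>
  show ?thesis
  proof (cases "s + fst a < r + snd a")
    case False
    let ?A = "subpair X (topspace X, preim X (g \<circ> \<phi>) {s + fst a<..} \<union> preim X (g \<circ> \<phi>) {..<r + snd a})"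
    have "\<not> (arctan (s + fst a) < arctan (r + snd a))" using False by (simp add: arctan_less_iff)
    then have "alpha a p \<in> fund_dom"
      using alpha_strip[OF p(2), of a] alpha_below_next_domain[OF p(1) a(3)]
      by (auto simp: fund_dom_iff p_eq alpha_arctan)
    then have pa: "alpha a p \<in> fund_dom" "alpha a (T_pow (level u) u) \<in> fund_dom"
      using u(2) by (auto simp: p_def)
    note la = level_alpha_same[OF u(1) pa(2), folded u(2), folded p_def]
    \<comment> \<open>Otherwise the internal map across the two levels would be zero by definition.\<close>
    have le: "alpha c u \<preceq> strip_T (alpha a u)"
    proof -
      have "alpha c p \<preceq> strip_T (alpha a p)"
        using arctan_bounded[of "s + fst c"] arctan_bounded[of "r + snd c"] arctan_bounded[of "s + fst a"]
          arctan_bounded[of "r + snd a"]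
        unfolding p_eq alpha_arctan preceq_def strip_T_def fst_conv snd_conv by linarith
      then show ?thesis
        unfolding p_def by (metis T_pow_mono_iff T_pow_strip_T alpha_T_pow)
    qed
    have mor: "mor (h_fun \<H> X (g \<circ> \<phi>)) (alpha a u) (alpha c u)
      = mv_differential \<H> n X (superlevel_pair X (g \<circ> \<phi>) (g \<circ> \<phi>) (s + fst c) (s + fst a))
          (sublevel_pair X (g \<circ> \<phi>) (g \<circ> \<phi>) (r + snd c) (r + snd a))"
      by (simp add: h_fun_def Let_def la lc le mv_rectangle_def T_inv_def p_eq alpha_arctan interlevel_def
          rho_lower_left rho_upper_right superlevel_pair_def sublevel_pair_def)
    have vec: "h_vec \<H> X f (g \<circ> \<phi>) u = Hmap \<H> n (subpair X (topspace X, preim X f {s<..} \<union> preim X f {..<r})) ?A id"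
      using pa(1) unfolding h_vec_def Let_def a(1)[symmetric] u(2)[symmetric] p_def[symmetric]
      by (simp add: mem_alpha_image p_eq alpha_arctan interlevel_square)
    have "commuting_square (carrier (Hgrp \<H> (n - 1) ?C)) (carrier (Hgrp \<H> n ?A))
      (mv_differential \<H> n X (superlevel_pair X (g \<circ> \<phi>) (g \<circ> \<phi>) (s + fst c) (s + fst a))
        (sublevel_pair X (g \<circ> \<phi>) (g \<circ> \<phi>) (r + snd c) (r + snd a)))
      (Hmap \<H> (n - 1) ?C ?C id)
      (Hmap \<H> n (subpair X (topspace X, preim X f {s<..} \<union> preim X f {..<r})) ?A id)
      (mv_differential \<H> n X ?U ?L)"
    proof (rule mv_level_natural[OF continuous_map_id cont(2) cont' cont' cont'])
      fix x assume x: "x \<in> topspace X"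
      show "s < f x \<Longrightarrow> s + fst c < (g \<circ> \<phi>) x" "f x < r \<Longrightarrow> (g \<circ> \<phi>) x < r + snd c"
        "s < f x \<Longrightarrow> s + fst a < (g \<circ> \<phi>) (id x)" "f x < r \<Longrightarrow> (g \<circ> \<phi>) (id x) < r + snd a"
        using a(4)[OF x] ac by auto
    qed (use ac u False in auto)
    then show ?thesis
      using w Hmap_id[OF pC(1) w] unfolding lhs mor vec w_def[symmetric] commuting_square_def by metis
  next
    case True
    let ?A = "subpair X (preim X (g \<circ> \<phi>) {s + fst a<..} \<inter> preim X (g \<circ> \<phi>) {..<r + snd a}, {})"
    note la = level_alpha_pred[OF u(3)[unfolded u(2)] True, folded u(2)]
    have mor: "mor (h_fun \<H> X (g \<circ> \<phi>)) (alpha a u) (alpha c u) = Hmap \<H> (n - 1) ?A ?C id"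
      by (simp add: h_fun_def Let_def la lc interlevel_T_inv)
    have "alpha a p \<notin> fund_dom" using True by (simp add: p_eq alpha_arctan fund_dom_iff arctan_le_iff)
    then have vec: "h_vec \<H> X f (g \<circ> \<phi>) u = mv_differential \<H> n X (superlevel_pair X (g \<circ> \<phi>) f (s + fst a) s)
        (sublevel_pair X (g \<circ> \<phi>) f (r + snd a) r)"
      unfolding h_vec_def Let_def a(1)[symmetric] u(2)[symmetric] p_def[symmetric]
      by (simp add: mem_alpha_image p_eq mv_rectangle_def T_inv_def alpha_lower_left alpha_upper_right
          rho_lower_left rho_upper_right superlevel_pair_def sublevel_pair_def)
    have "commuting_square (carrier (Hgrp \<H> (n - 1) ?C))
      (carrier (Hgrp \<H> n (subpair X (topspace X, preim X f {s<..} \<union> preim X f {..<r}))))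
      (mv_differential \<H> n X ?U ?L)
      (Hmap \<H> (n - 1) ?A ?C id)
      (Hmap \<H> n (subpair X (topspace X, preim X f {s<..} \<union> preim X f {..<r}))
        (subpair X (topspace X, preim X f {s<..} \<union> preim X f {..<r})) id)
      (mv_differential \<H> n X (superlevel_pair X (g \<circ> \<phi>) f (s + fst a) s) (sublevel_pair X (g \<circ> \<phi>) f (r + snd a) r))"
    proof (rule mv_level_natural[OF continuous_map_id cont(2) cont' cont(2) cont'])
      fix x assume x: "x \<in> topspace X"
      show "s < f x \<Longrightarrow> s + fst c < (g \<circ> \<phi>) x" "f x < r \<Longrightarrow> (g \<circ> \<phi>) x < r + snd c"
        "s < f x \<Longrightarrow> s + fst a < (g \<circ> \<phi>) x" "f x < r \<Longrightarrow> (g \<circ> \<phi>) x < r + snd a"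
        using a(4)[OF x] ac by auto
    qed (use ac u True in auto)
    then show ?thesis
      using w Hmap_id[OF pX] unfolding lhs mor vec w_def[symmetric] commuting_square_def by metis
  qed
qed

text \<open>The end \<open>x \<mapsto> (x, \<tau>)\<close> of the cylinder carries the pairs formed from \<open>f\<close> and \<open>g \<phi>\<close> into those
  formed from \<open>F\<close> and \<open>G\<close>, and \<open>\<phi>\<close> is this end followed by \<open>\<Gamma>\<close>.\<close>
lemma mv_level_cylinder:
  fixes \<Gamma> :: "'u \<times> real \<Rightarrow> 'u"
  assumes cont: "continuous_map X euclideanreal f" "continuous_map Y euclideanreal g"
      "continuous_map (prod_topology X (top_of_set {0..1})) Y \<Gamma>"
    and c: "\<And>x t. x \<in> topspace X \<Longrightarrow> t \<in> {0..1} \<Longrightarrow> c1 \<le> g (\<Gamma> (x, t)) - f x \<and> g (\<Gamma> (x, t)) - f x \<le> c2"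
    and rs: "r \<le> s" "s + c1 < r + c2" and \<tau>: "\<tau> \<in> {0..1}"
    and z: "z \<in> carrier (Hgrp \<H> (n - 1) (subpair Y (preim Y g {s + c1<..} \<inter> preim Y g {..<r + c2}, {})))"
  defines "\<phi> \<equiv> \<lambda>x. \<Gamma> (x, \<tau>)" and "F \<equiv> f \<circ> base" and "G \<equiv> g \<circ> (\<Gamma> \<circ> decode)" and "C \<equiv> cylinder X"
  shows "mv_differential \<H> n X (superlevel_pair X (g \<circ> \<phi>) f (s + c1) s) (sublevel_pair X (g \<circ> \<phi>) f (r + c2) r)
       (Hmap \<H> (n - 1) (subpair X (preim X (g \<circ> \<phi>) {s + c1<..} \<inter> preim X (g \<circ> \<phi>) {..<r + c2}, {}))
         (subpair Y (preim Y g {s + c1<..} \<inter> preim Y g {..<r + c2}, {})) \<phi> z)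
    = Hmap \<H> n (subpair X (topspace X, preim X f {s<..} \<union> preim X f {..<r}))
        (subpair C (topspace C, preim C F {s<..} \<union> preim C F {..<r})) (\<lambda>x. encode (x, \<tau>))
        (mv_differential \<H> n C (superlevel_pair C G F (s + c1) s) (sublevel_pair C G F (r + c2) r)
          (Hmap \<H> (n - 1) (subpair C (preim C G {s + c1<..} \<inter> preim C G {..<r + c2}, {}))
            (subpair Y (preim Y g {s + c1<..} \<inter> preim Y g {..<r + c2}, {})) (\<Gamma> \<circ> decode) z))"
    and "mv_differential \<H> n C (superlevel_pair C G F (s + c1) s) (sublevel_pair C G F (r + c2) r)
          (Hmap \<H> (n - 1) (subpair C (preim C G {s + c1<..} \<inter> preim C G {..<r + c2}, {}))
            (subpair Y (preim Y g {s + c1<..} \<inter> preim Y g {..<r + c2}, {})) (\<Gamma> \<circ> decode) z)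
      \<in> carrier (Hgrp \<H> n (subpair C (topspace C, preim C F {s<..} \<union> preim C F {..<r})))"
proof -
  let ?XM = "subpair X (preim X (g \<circ> \<phi>) {s + c1<..} \<inter> preim X (g \<circ> \<phi>) {..<r + c2}, {})"
    and ?CM = "subpair C (preim C G {s + c1<..} \<inter> preim C G {..<r + c2}, {})"
    and ?YM = "subpair Y (preim Y g {s + c1<..} \<inter> preim Y g {..<r + c2}, {})"
  define i :: "'u \<Rightarrow> 'u" where "i = (\<lambda>x. encode (x, \<tau>))"
  have i: "continuous_map X C i"
    unfolding i_def C_def using \<tau> by (intro continuous_into_cylinder) auto
  have \<Gamma>: "continuous_map C Y (\<Gamma> \<circ> decode)"
    unfolding C_def by (rule continuous_map_compose[OF continuous_decode cont(3)])
  have \<Gamma>i: "\<Gamma> \<circ> decode \<circ> i = \<phi>" "base \<circ> i = id" by (auto simp: i_def \<phi>_def)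
  have \<phi>: "continuous_map X Y \<phi>" using continuous_map_compose[OF i \<Gamma>] \<Gamma>i by simp
  have Gi: "G (i x) = (g \<circ> \<phi>) x" "F (i x) = f x" for x by (auto simp: i_def G_def F_def \<phi>_def)
  have cFG: "continuous_map C euclideanreal F" "continuous_map C euclideanreal G"
    "continuous_map X euclideanreal (g \<circ> \<phi>)"
    unfolding F_def G_def C_def using continuous_map_compose[OF continuous_base cont(1)]
      continuous_map_compose[OF \<Gamma> cont(2)] continuous_map_compose[OF \<phi> cont(2)] by (simp_all add: C_def)
  have GF: "c1 \<le> G y - F y \<and> G y - F y \<le> c2" if "y \<in> topspace C" for y
    using that c by (auto simp: C_def topspace_cylinder G_def F_def)
  have sq: "commuting_square (carrier (Hgrp \<H> (n - 1) ?CM))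
    (carrier (Hgrp \<H> n (subpair C (topspace C, preim C F {s<..} \<union> preim C F {..<r}))))
    (mv_differential \<H> n C (superlevel_pair C G F (s + c1) s) (sublevel_pair C G F (r + c2) r))
    (Hmap \<H> (n - 1) ?XM ?CM i)
    (Hmap \<H> n (subpair X (topspace X, preim X f {s<..} \<union> preim X f {..<r}))
      (subpair C (topspace C, preim C F {s<..} \<union> preim C F {..<r})) i)
    (mv_differential \<H> n X (superlevel_pair X (g \<circ> \<phi>) f (s + c1) s) (sublevel_pair X (g \<circ> \<phi>) f (r + c2) r))"
  proof (rule mv_level_natural[OF i cont(1) cFG(3) cFG(1,2)])
    fix x assume "x \<in> topspace X"
    then have "c1 \<le> (g \<circ> \<phi>) x - f x \<and> (g \<circ> \<phi>) x - f x \<le> c2" using c \<tau> by (simp add: \<phi>_def)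
    then show "s < f x \<Longrightarrow> s + c1 < (g \<circ> \<phi>) x" "f x < r \<Longrightarrow> (g \<circ> \<phi>) x < r + c2" by auto
  next
    fix y assume "y \<in> topspace C"
    then show "s < F y \<Longrightarrow> s + c1 < G y" "F y < r \<Longrightarrow> G y < r + c2" using GF[of y] by auto
  qed (use rs in \<open>auto simp: Gi\<close>)
  have pairs: "is_pair ?XM" "is_pair ?CM" "is_pair ?YM" by (simp_all add: subpair_def)
  have iXC: "pair_map ?XM ?CM i"
    by (rule pair_map_subpair[OF i])
      (use continuous_map_image_subset_topspace[OF i] in \<open>auto simp: preim_def Gi\<close>)
  have CY: "pair_map ?CM ?YM (\<Gamma> \<circ> decode)"
    by (rule pair_map_subpair[OF \<Gamma>])
      (use continuous_map_image_subset_topspace[OF \<Gamma>] in \<open>auto simp: preim_def G_def\<close>)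
  have "Hmap \<H> (n - 1) ?XM ?YM \<phi> z = Hmap \<H> (n - 1) ?XM ?CM i (Hmap \<H> (n - 1) ?CM ?YM (\<Gamma> \<circ> decode) z)"
    using Hmap_comp[OF pairs iXC CY z] by (simp add: \<Gamma>i)
  moreover have "Hmap \<H> (n - 1) ?CM ?YM (\<Gamma> \<circ> decode) z \<in> carrier (Hgrp \<H> (n - 1) ?CM)"
    by (rule Hmap_closed[OF pairs(2,3) CY z])
  ultimately show "mv_differential \<H> n X (superlevel_pair X (g \<circ> \<phi>) f (s + c1) s) (sublevel_pair X (g \<circ> \<phi>) f (r + c2) r)
       (Hmap \<H> (n - 1) ?XM ?YM \<phi> z)
    = Hmap \<H> n (subpair X (topspace X, preim X f {s<..} \<union> preim X f {..<r}))
        (subpair C (topspace C, preim C F {s<..} \<union> preim C F {..<r})) (\<lambda>x. encode (x, \<tau>))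
        (mv_differential \<H> n C (superlevel_pair C G F (s + c1) s) (sublevel_pair C G F (r + c2) r)
          (Hmap \<H> (n - 1) ?CM ?YM (\<Gamma> \<circ> decode) z))"
    and "mv_differential \<H> n C (superlevel_pair C G F (s + c1) s) (sublevel_pair C G F (r + c2) r)
          (Hmap \<H> (n - 1) ?CM ?YM (\<Gamma> \<circ> decode) z)
      \<in> carrier (Hgrp \<H> n (subpair C (topspace C, preim C F {s<..} \<union> preim C F {..<r})))"
    using sq unfolding commuting_square_def i_def[symmetric] by metis+
qed

lemma Hmap_homotopic:
  assumes "is_pair P" "is_pair Q"
    and "continuous_map (prod_topology (fst P) (top_of_set {0..1})) (fst Q) \<Gamma>"
    and "\<And>x t. x \<in> snd P \<Longrightarrow> t \<in> {0..1} \<Longrightarrow> \<Gamma> (x, t) \<in> snd Q"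
    and z: "z \<in> carrier (Hgrp \<H> n Q)"
  shows "Hmap \<H> n P Q (\<lambda>x. \<Gamma> (x, 0)) z = Hmap \<H> n P Q (\<lambda>x. \<Gamma> (x, 1::real)) z"
proof -
  let ?I = "top_of_set {0..1::real}" and ?sw = "\<lambda>z. (snd z, fst z)"
  have "continuous_map (prod_topology ?I (fst P)) (prod_topology (fst P) ?I) ?sw"
    using continuous_map_fst[of ?I "fst P"] continuous_map_snd[of ?I "fst P"]
    by (simp add: continuous_map_pairwise o_def)
  then have "continuous_map (prod_topology ?I (fst P)) (fst Q) (\<Gamma> \<circ> ?sw)"
    using continuous_map_compose assms(3) by blast
  then have "homotopic_with (\<lambda>\<kappa>. \<kappa> ` snd P \<subseteq> snd Q) (fst P) (fst Q) (\<lambda>x. \<Gamma> (x, 0)) (\<lambda>x. \<Gamma> (x, 1))"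
    unfolding homotopic_with_def by (intro exI[of _ "\<Gamma> \<circ> ?sw"]) (use assms(4) in auto)
  then show ?thesis
    using homotopy[of "fst P" "snd P" "fst Q" "snd Q"] assms by simp
qed

end

theorem proposition4p9:
  fixes K :: "'k ring"
    and \<H> :: "('u, 'k, 'v) cohomology"
    and X Y :: "'u topology"
    and f g :: "'u \<Rightarrow> real"
    and \<Gamma> :: "'u \<times> real \<Rightarrow> 'u"
    and \<phi> \<psi> :: "'u \<Rightarrow> 'u"
    and XI :: "('u \<times> real) topology"
    and a b c :: "real \<times> real"
  assumes universe: "\<exists>e :: 'u \<times> real \<Rightarrow> 'u. inj e"
    and theory_H: "cohomology_theory K \<H>"
    and nonempty: "topspace X \<noteq> {}"
    and cont_f: "continuous_map X euclideanreal f"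
    and cont_g: "continuous_map Y euclideanreal g"
    and XI_eq: "XI = prod_topology X (top_of_set {0..1})"
    and cont_\<Gamma>: "continuous_map XI Y \<Gamma>"
    and finite_dist: "finite_pair (dist_ext (topspace XI) (f \<circ> fst) (g \<circ> \<Gamma>))"
    and \<phi>_eq: "\<phi> = (\<lambda>x. \<Gamma> (x, 0))"
    and \<psi>_eq: "\<psi> = (\<lambda>x. \<Gamma> (x, 1))"
    and a_eq: "a = dist_vec (topspace X) f (g \<circ> \<phi>)"
    and b_eq: "b = dist_vec (topspace X) f (g \<circ> \<psi>)"
    and c_eq: "c = dist_vec (topspace XI) (f \<circ> fst) (g \<circ> \<Gamma>)"
  shows "\<forall>u\<in>strip. \<forall>z\<in>carrier (ob (shift (h_fun \<H> Y g) c) u).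
    (h_vec \<H> X f (g \<circ> \<phi>) \<odot>\<odot> shift_le (h_fun \<H> X (g \<circ> \<phi>)) a c \<odot>\<odot> shift_nt (h_ind \<H> X Y g \<phi>) c) u z =
    (h_vec \<H> X f (g \<circ> \<psi>) \<odot>\<odot> shift_le (h_fun \<H> X (g \<circ> \<psi>)) b c \<odot>\<odot> shift_nt (h_ind \<H> X Y g \<psi>) c) u z"
proof (intro ballI)
  interpret cohomology_with_cylinders K \<H>
    using universe theory_H by (simp add: cohomology_with_cylinders_def cohomology_with_cylinders_axioms_def)
  have \<Gamma>: "continuous_map (prod_topology X (top_of_set {0..1})) Y \<Gamma>" using cont_\<Gamma> XI_eq by simp
  have c: "fst c \<le> g (\<Gamma> (x, t)) - f x \<and> g (\<Gamma> (x, t)) - f x \<le> snd c"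
    if "x \<in> topspace X" "t \<in> {0..1}" for x t
    using finite_dist_vec_bounds[OF finite_dist, of "(x, t)"] that by (simp add: XI_eq c_eq)
  have bounds: "d \<preceq> c \<and> fst d \<le> snd d \<and>
      (\<forall>x\<in>topspace X. fst d \<le> g (\<kappa> x) - f x \<and> g (\<kappa> x) - f x \<le> snd d)"
    if "\<kappa> = (\<lambda>x. \<Gamma> (x, t))" "t \<in> {0..1}" "d = dist_vec (topspace X) f (g \<circ> \<kappa>)" for \<kappa> t d
  proof -
    have k: "fst c \<le> (g \<circ> \<kappa>) x - f x \<and> (g \<circ> \<kappa>) x - f x \<le> snd c" if "x \<in> topspace X" for x
      using c that \<open>\<kappa> = _\<close> \<open>t \<in> _\<close> by simp
    have d: "fst c \<le> fst d" "snd d \<le> snd c"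
      "\<And>x. x \<in> topspace X \<Longrightarrow> fst d \<le> (g \<circ> \<kappa>) x - f x \<and> (g \<circ> \<kappa>) x - f x \<le> snd d"
      unfolding \<open>d = _\<close>
      using dist_vec_bounds[where g = "g \<circ> \<kappa>" and f = f and ?c1.0 = "fst c" and ?c2.0 = "snd c", OF nonempty] k
      by blast+
    obtain x0 where x0: "x0 \<in> topspace X" using nonempty by blast
    have "fst d \<le> snd d" using d(3)[OF x0] by linarith
    then show ?thesis using d by (simp add: preceq_def)
  qed
  note a = bounds[OF \<phi>_eq _ a_eq, simplified] and b = bounds[OF \<psi>_eq _ b_eq, simplified]
  have end_cont: "continuous_map X Y (\<lambda>x. \<Gamma> (x, t))" if "t \<in> {0..1}" for t
    using continuous_map_compose[OF _ \<Gamma>, of X "\<lambda>x. (x, t)"] that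
    by (simp add: o_def continuous_map_pairwise)
  have \<phi>: "continuous_map X Y \<phi>" and \<psi>: "continuous_map X Y \<psi>"
    using end_cont[of 0] end_cont[of 1] by (simp_all add: \<phi>_eq \<psi>_eq)
  fix u z assume u: "u \<in> strip" and z: "z \<in> carrier (ob (shift (h_fun \<H> Y g) c) u)"
  define n p where "n = level u" and "p = T_pow n u"
  have p: "p \<in> fund_dom" "p \<in> strip" using T_pow_level[OF u] u by (auto simp: p_def n_def T_pow_strip)
  show "(h_vec \<H> X f (g \<circ> \<phi>) \<odot>\<odot> shift_le (h_fun \<H> X (g \<circ> \<phi>)) a c \<odot>\<odot> shift_nt (h_ind \<H> X Y g \<phi>) c) u z =
    (h_vec \<H> X f (g \<circ> \<psi>) \<odot>\<odot> shift_le (h_fun \<H> X (g \<circ> \<psi>)) b c \<odot>\<odot> shift_nt (h_ind \<H> X Y g \<psi>) c) u z"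
  proof (cases "alpha c p \<in> fund_dom")
    case True
    let ?P = "subpair X (interlevel X f p)" and ?Q = "subpair Y (interlevel Y g (alpha c p))"
    have lc: "level (alpha c u) = n" "T_pow n (alpha c u) = alpha c p"
      using level_alpha_same[OF u, of c] True by (auto simp: p_def n_def)
    have z': "z \<in> carrier (Hgrp \<H> n ?Q)" using z by (simp add: shift_def h_fun_def Let_def lc)
    have pairs: "is_pair ?P" "is_pair ?Q" by (intro is_pair_interlevel alpha_strip p)+
    have rho: "x \<in> topspace X \<Longrightarrow> t \<in> {0..1} \<Longrightarrow> f x \<in> \<rho>1 p \<Longrightarrow> g (\<Gamma> (x, t)) \<in> \<rho>1 (alpha c p)"
      "x \<in> topspace X \<Longrightarrow> t \<in> {0..1} \<Longrightarrow> f x \<in> \<rho>0 p \<Longrightarrow> g (\<Gamma> (x, t)) \<in> \<rho>0 (alpha c p)" for x t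
      using rho_alpha[of c "g (\<Gamma> (x, t)) - f x" "f x" p] c[of x t] by auto
    have \<Gamma>top: "x \<in> topspace X \<Longrightarrow> t \<in> {0..1} \<Longrightarrow> \<Gamma> (x, t) \<in> topspace Y" for x t
      using continuous_map_image_subset_topspace[OF \<Gamma>] by auto
    have "Hmap \<H> n ?P ?Q (\<lambda>x. \<Gamma> (x, 0)) z = Hmap \<H> n ?P ?Q (\<lambda>x. \<Gamma> (x, 1)) z"
    proof (rule Hmap_homotopic[OF pairs _ _ z'])
      have "prod_topology (fst ?P) (top_of_set {0..1}) =
          subtopology (prod_topology X (top_of_set {0..1})) (fst (interlevel X f p) \<times> {0..1::real})"
        by (simp add: subpair_def subtopology_Times subtopology_subtopology)
      then show "continuous_map (prod_topology (fst ?P) (top_of_set {0..1})) (fst ?Q) \<Gamma>"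
        using \<Gamma> rho(1) \<Gamma>top
        by (auto simp: subpair_def continuous_map_in_subtopology continuous_map_from_subtopology interlevel_def preim_def)
    qed (use rho(2) \<Gamma>top in \<open>auto simp: subpair_def interlevel_def preim_def\<close>)
    then show ?thesis
      using composite_same_level[OF \<phi> a_eq _ _ _ u n_def p_def True z'] a
        composite_same_level[OF \<psi> b_eq _ _ _ u n_def p_def True z'] b
      by (simp add: \<phi>_eq \<psi>_eq)
  next
    case False
    have "fst c \<le> snd c" using a by (auto simp: preceq_def)
    then obtain s r where p': "p = (arctan s, arctan r)" and rs: "r \<le> s" "s + fst c < r + snd c"
      using alpha_leaves_domain[OF p(1) _ False] by metis
    define C F G where "C = (cylinder X :: 'u topology)" and "F = f \<circ> base" and "G = g \<circ> (\<Gamma> \<circ> decode)"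
    have lc: "level (alpha c u) = n - 1" "T_pow (n - 1) (alpha c u) = T_inv (arctan (s + fst c), arctan (r + snd c))"
      using level_alpha_pred[of u s r c] rs p' by (auto simp: p_def n_def)
    have z': "z \<in> carrier (Hgrp \<H> (n - 1) (subpair Y (preim Y g {s + fst c<..} \<inter> preim Y g {..<r + snd c}, {})))"
      using z by (simp add: shift_def h_fun_def Let_def lc interlevel_T_inv)
    let ?P = "subpair X (topspace X, preim X f {s<..} \<union> preim X f {..<r})"
      and ?Q = "subpair C (topspace C, preim C F {s<..} \<union> preim C F {..<r})"
    note cyl = mv_level_cylinder[OF cont_f cont_g \<Gamma> c rs _ z', folded C_def F_def G_def]
    \<comment> \<open>The class whose restrictions to the two ends of the cylinder are the two composites.\<close>
    define w where "w = mv_differential \<H> n C (superlevel_pair C G F (s + fst c) s) (sublevel_pair C G F (r + snd c) r)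
          (Hmap \<H> (n - 1) (subpair C (preim C G {s + fst c<..} \<inter> preim C G {..<r + snd c}, {}))
            (subpair Y (preim Y g {s + fst c<..} \<inter> preim Y g {..<r + snd c}, {})) (\<Gamma> \<circ> decode) z)"
    have w: "w \<in> carrier (Hgrp \<H> n ?Q)" unfolding w_def by (rule cyl(2)[of 0]) auto
    have "Hmap \<H> n ?P ?Q (\<lambda>x. encode (x, 0)) w = Hmap \<H> n ?P ?Q (\<lambda>x. encode (x, 1)) w"
    proof (rule Hmap_homotopic[OF _ _ _ _ w, where \<Gamma> = encode])
      have "continuous_map (prod_topology X (top_of_set {0..1})) C (\<lambda>z. encode (fst z, snd z))"
        unfolding C_def
        by (rule continuous_into_cylinder)
          (use continuous_map_snd[of X "top_of_set {0..1::real}"] in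
            \<open>auto simp: continuous_map_fst continuous_map_in_subtopology\<close>)
      then show "continuous_map (prod_topology (fst ?P) (top_of_set {0..1})) (fst ?Q) encode"
        by (simp add: subpair_def)
    qed (auto simp: is_pair_def subpair_def preim_def C_def F_def topspace_cylinder)
    moreover have "T_pow n u = (arctan s, arctan r)" using p' by (simp add: p_def)
    ultimately show ?thesis
      using composite_lower_level[OF \<phi> cont_f cont_g a_eq _ _ _ u n_def _ rs z'] a cyl(1)[of 0]
        composite_lower_level[OF \<psi> cont_f cont_g b_eq _ _ _ u n_def _ rs z'] b cyl(1)[of 1]
      by (simp add: \<phi>_eq[symmetric] \<psi>_eq[symmetric] w_def[symmetric])
  qed
qed

end
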